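(* Assume that the finite-dimensional operator $T : V_h \to V_h$, $T := R_h \mathcal{A}^{-1}\mathcal{L}|_{V_h}$, is nonsingular. Let $S : V_\bot \to V_\bot$ be the linear operator $$S := I_{V_\bot} - \mathcal{A}_\bot^{-1} f'[\hat u]|_{V_\bot} - \mathcal{A}_\bot^{-1} f'[\hat u]|_{V_h}\, T^{-1} \mathcal{A}_h^{-1} f'[\hat u]|_{V_\bot}.$$ If $S$ is nonsingular, then the operators $D : V_h\times V_\bot \to V_h\times V_\bot$ and $\mathcal{L} : H^1_0(\Omega)\to H^{-1}(\Omega)$ are also nonsingular, and for every $g \in H^{-1}(\Omega)$ the solution $(\phi_h,\phi_\bot)^T \in V_h\times V_\bot$ of $$D\begin{pmatrix}\phi_h\\ \phi_\bot\end{pmatrix} = \begin{pmatrix}\mathcal{A}_h^{-1} g\\ \mathcal{A}_\bot^{-1} g\end{pmatrix}$$ is represented as $$\begin{pmatrix}\phi_h\\ \phi_\bot\end{pmatrix} = \begin{pmatrix} T^{-1} + T^{-1}\mathcal{A}_h^{-1} f'[\hat u]|_{V_\bot} S^{-1}\mathcal{A}_\bot^{-1} f'[\hat u]|_{V_h} T^{-1} & T^{-1}\mathcal{A}_h^{-1} f'[\hat u]|_{V_\bot} S^{-1}\\ S^{-1}\mathcal{A}_\bot^{-1} f'[\hat u]|_{V_h} T^{-1} & S^{-1}\end{pmatrix}\begin{pmatrix}\mathcal{A}_h^{-1} g\\ \mathcal{A}_\bot^{-1} g\end{pmatrix}.$$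
   Context: Setting. $\Omega\subset\mathbb{R}^n$ ($n=1,2,3$) is a bounded domain with Lipschitz boundary. $H^1_0(\Omega)$ is equipped with the inner product $(u,w)_{H^1_0} := (\nabla u,\nabla w)_{L^2}$, and $H^{-1}(\Omega)$ is its topological dual. $f : H^1_0(\Omega)\to H^{-1}(\Omega)$ is a given nonlinear function, $V_h\subset H^1_0(\Omega)$ is a finite-dimensional subspace, $\hat u\in V_h$ is given, and $f'[\hat u] : H^1_0(\Omega)\to H^{-1}(\Omega)$ is the Fréchet derivative of $f$ at $\hat u$ (a bounded linear operator). $\mathcal{A} : H^1_0(\Omega)\to H^{-1}(\Omega)$ is the weak Laplace operator, i.e. $\langle \mathcal{A}u, v\rangle = (\nabla u,\nabla v)_{L^2}$ (it is bijective). $R_h : H^1_0(\Omega)\to V_h$ is the Ritz projection, defined by $((I-R_h)u, v_h)_{H^1_0}=0$ for all $v_h\in V_h$, and $V_\bot := \{u\in H^1_0(\Omega) : (u,v_h)_{H^1_0}=0 \text{ for all } v_h\in V_h\}$ is the orthogonal complement of $V_h$. $I_{V_\bot}$ is the identity on $V_\bot$. Put $\mathcal{A}_h^{-1} := R_h\mathcal{A}^{-1}$, $\mathcal{A}_\bot^{-1} := (I-R_h)\mathcal{A}^{-1}$, and $\mathcal{L} := \mathcal{A}-f'[\hat u] : H^1_0(\Omega)\to H^{-1}(\Omega)$. The block operator $D$ on $V_h\times V_\bot$ is $$D := \begin{pmatrix} T & -\mathcal{A}_h^{-1} f'[\hat u]|_{V_\bot}\\ -\mathcal{A}_\bot^{-1}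 f'[\hat u]|_{V_h} & I_{V_\bot}-\mathcal{A}_\bot^{-1} f'[\hat u]|_{V_\bot}\end{pmatrix}.$$ "Nonsingular" means invertible (bijective). *)

theory Defs
  imports "HOL-Analysis.Analysis"
begin

section \<open>The space L2\<close>

definition sq_integrable :: "('a::euclidean_space \<Rightarrow> real) \<Rightarrow> bool" where
  "sq_integrable f \<longleftrightarrow> f \<in> borel_measurable borel \<and> integrable lborel (\<lambda>x. (f x)\<^sup>2)"

definition l2_rel :: "('a::euclidean_space \<Rightarrow> real) \<Rightarrow> ('a \<Rightarrow> real) \<Rightarrow> bool" where
  "l2_rel f g \<longleftrightarrow> sq_integrable f \<and> sq_integrable g \<and> (AE x in lborel. f x = g x)"

lemma sq_integrable_zero: "sq_integrable (\<lambda>_. 0)"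
  by (simp add: sq_integrable_def)

lemma sq_integrable_mult:
  assumes "sq_integrable f" "sq_integrable g"
  shows "integrable lborel (\<lambda>x. f x * g x)"
proof (rule Bochner_Integration.integrable_bound)
  show "integrable lborel (\<lambda>x. (f x)\<^sup>2 + (g x)\<^sup>2)"
    using assms by (simp add: sq_integrable_def)
  show "(\<lambda>x. f x * g x) \<in> borel_measurable lborel"
    using assms by (auto simp: sq_integrable_def)
  show "AE x in lborel. norm (f x * g x) \<le> norm ((f x)\<^sup>2 + (g x)\<^sup>2)"
  proof (rule AE_I2)
    fix x
    have "2 * \<bar>f x * g x\<bar> \<le> (f x)\<^sup>2 + (g x)\<^sup>2"
      using sum_squares_bound[of "\<bar>f x\<bar>" "\<bar>g x\<bar>"] by (simp add: abs_mult)
    then show "norm (f x * g x) \<le> norm ((f x)\<^sup>2 + (g x)\<^sup>2)"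
      by simp
  qed
qed

lemma sq_integrable_add:
  assumes "sq_integrable f" "sq_integrable g"
  shows "sq_integrable (\<lambda>x. f x + g x)"
  using assms sq_integrable_mult[OF assms]
  by (auto simp: sq_integrable_def power2_sum mult.assoc)

lemma sq_integrable_scale:
  assumes "sq_integrable f"
  shows "sq_integrable (\<lambda>x. c * f x)"
  using assms by (auto simp: sq_integrable_def power_mult_distrib)

text \<open>The elements of \<open>'a l2\<close> are classes of functions on the whole space modulo equality
  almost everywhere. Borel representatives lose nothing, since every Lebesgue measurable function
  is equal to a Borel measurable one almost everywhere.\<close>

quotient_type (overloaded) 'a l2 = "'a::euclidean_space \<Rightarrow> real" / partial: l2_rel
proof (rule part_equivpI)
  show "\<exists>f :: 'a \<Rightarrow> real. l2_rel f f"
    by (rule exI[of _ "\<lambda>_. 0"]) (simp add: l2_rel_def sq_integrable_zero)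
  show "symp (l2_rel :: ('a \<Rightarrow> real) \<Rightarrow> _)"
    by (rule sympI) (auto simp: l2_rel_def eq_commute)
  show "transp (l2_rel :: ('a \<Rightarrow> real) \<Rightarrow> _)"
    by (rule transpI) (auto simp: l2_rel_def)
qed

instantiation l2 :: (euclidean_space) real_inner
begin

lift_definition zero_l2 :: "'a l2" is "\<lambda>_. 0"
  by (simp add: l2_rel_def sq_integrable_zero)

lift_definition plus_l2 :: "'a l2 \<Rightarrow> 'a l2 \<Rightarrow> 'a l2" is "\<lambda>f g x. f x + g x"
  by (auto simp: l2_rel_def sq_integrable_add)

lift_definition scaleR_l2 :: "real \<Rightarrow> 'a l2 \<Rightarrow> 'a l2" is "\<lambda>c f x. c * f x"
  by (auto simp: l2_rel_def sq_integrable_scale)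

lift_definition uminus_l2 :: "'a l2 \<Rightarrow> 'a l2" is "\<lambda>f x. - f x"
  using sq_integrable_scale[of _ "-1"] by (auto simp: l2_rel_def)

definition minus_l2 :: "'a l2 \<Rightarrow> 'a l2 \<Rightarrow> 'a l2" where
  "minus_l2 u v = u + - v"

lift_definition inner_l2 :: "'a l2 \<Rightarrow> 'a l2 \<Rightarrow> real" is "\<lambda>f g. \<integral>x. f x * g x \<partial>lborel"
proof -
  fix f f' g g' :: "'a \<Rightarrow> real"
  assume *: "l2_rel f f'" "l2_rel g g'"
  then have "AE x in lborel. f x * g x = f' x * g' x"
    by (auto simp: l2_rel_def)
  with * show "(\<integral>x. f x * g x \<partial>lborel) = (\<integral>x. f' x * g' x \<partial>lborel)"
    by (intro integral_cong_AE) (auto simp: l2_rel_def sq_integrable_def)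
qed

definition norm_l2 :: "'a l2 \<Rightarrow> real" where
  "norm_l2 u = sqrt (inner u u)"

definition sgn_l2 :: "'a l2 \<Rightarrow> 'a l2" where
  "sgn_l2 u = inverse (norm u) *\<^sub>R u"

definition dist_l2 :: "'a l2 \<Rightarrow> 'a l2 \<Rightarrow> real" where
  "dist_l2 u v = norm (u - v)"

definition uniformity_l2 :: "('a l2 \<times> 'a l2) filter" where
  "uniformity_l2 = (INF e\<in>{0<..}. principal {(x, y). dist x y < e})"

definition open_l2 :: "'a l2 set \<Rightarrow> bool" where
  "open_l2 U = (\<forall>x\<in>U. eventually (\<lambda>(x', y). x' = x \<longrightarrow> y \<in> U) uniformity)"

instance
proof
  fix u v w :: "'a l2" and a b :: real and U :: "'a l2 set"
  show "u + v + w = u + (v + w)"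
    by transfer (auto simp: l2_rel_def add.assoc intro!: sq_integrable_add)
  show "u + v = v + u"
    by transfer (auto simp: l2_rel_def add.commute intro!: sq_integrable_add)
  show "0 + u = u"
    by transfer (auto simp: l2_rel_def)
  show "- u + u = 0"
    by transfer (auto simp: l2_rel_def sq_integrable_zero)
  show "u - v = u + - v"
    by (simp add: minus_l2_def)
  show "a *\<^sub>R (u + v) = a *\<^sub>R u + a *\<^sub>R v"
    by transfer (auto simp: l2_rel_def distrib_left intro!: sq_integrable_add sq_integrable_scale)
  show "(a + b) *\<^sub>R u = a *\<^sub>R u + b *\<^sub>R u"
    by transfer (auto simp: l2_rel_def distrib_right intro!: sq_integrable_add sq_integrable_scale)
  show "a *\<^sub>R b *\<^sub>R u = (a * b) *\<^sub>R u"
    by transfer (auto simp: l2_rel_def mult.assoc intro!: sq_integrable_scale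
        dest: sq_integrable_scale[of _ "a * b"])
  show "1 *\<^sub>R u = u"
    by transfer (auto simp: l2_rel_def)
  show "sgn u = inverse (norm u) *\<^sub>R u"
    by (simp add: sgn_l2_def)
  show "dist u v = norm (u - v)"
    by (simp add: dist_l2_def)
  show "(uniformity :: ('a l2 \<times> 'a l2) filter) = (INF e\<in>{0<..}. principal {(x, y). dist x y < e})"
    by (simp add: uniformity_l2_def)
  show "open U = (\<forall>x\<in>U. eventually (\<lambda>(x', y). x' = x \<longrightarrow> y \<in> U) uniformity)"
    by (simp add: open_l2_def)
  show "inner u v = inner v u"
    by transfer (simp add: mult.commute)
  show "inner (u + v) w = inner u w + inner v w"
    by transfer (simp add: l2_rel_def distrib_right sq_integrable_mult)
  show "inner (a *\<^sub>R u) v = a * inner u v"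
    by transfer (simp add: mult.assoc)
  show "0 \<le> inner u u"
    by transfer simp
  show "(inner u u = 0) = (u = 0)"
  proof transfer
    fix f :: "'a \<Rightarrow> real"
    assume "l2_rel f f"
    then have sq: "sq_integrable f" by (simp add: l2_rel_def)
    then have "(\<integral>x. f x * f x \<partial>lborel) = 0 \<longleftrightarrow> (AE x in lborel. f x * f x = 0)"
      using sq_integrable_mult[OF sq sq] by (intro integral_nonneg_eq_0_iff_AE) auto
    then show "((\<integral>x. f x * f x \<partial>lborel) = 0) = l2_rel f (\<lambda>_. 0)"
      using sq by (simp add: l2_rel_def sq_integrable_zero)
  qed
  show "norm u = sqrt (inner u u)"
    by (simp add: norm_l2_def)
qed

end


section \<open>Bounded Lipschitz domains and test functions\<close>

text \<open>Near every boundary point, the set is the part of a ball that lies above the graph of a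
  Lipschitz function over the hyperplane orthogonal to a unit vector \<open>e\<close>; the point
  \<open>y - (y \<bullet> e) e\<close> is the projection of \<open>y\<close> onto this hyperplane.\<close>

definition lipschitz_boundary :: "'a::euclidean_space set \<Rightarrow> bool" where
  "lipschitz_boundary \<Omega> \<longleftrightarrow>
     (\<forall>x\<in>frontier \<Omega>. \<exists>r>0. \<exists>e. norm e = 1 \<and>
       (\<exists>\<gamma> C. C-lipschitz_on {y. y \<bullet> e = 0} \<gamma> \<and>
          \<Omega> \<inter> ball x r = {y \<in> ball x r. y \<bullet> e > \<gamma> (y - (y \<bullet> e) *\<^sub>R e)}))"

definition bounded_lipschitz_domain :: "'a::euclidean_space set \<Rightarrow> bool" where
  "bounded_lipschitz_domain \<Omega> \<longleftrightarrow>
     open \<Omega> \<and> connected \<Omega> \<and> \<Omega> \<noteq> {} \<and> bounded \<Omega> \<and> lipschitz_boundary \<Omega>"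

definition partial_deriv :: "'a::euclidean_space \<Rightarrow> ('a \<Rightarrow> real) \<Rightarrow> 'a \<Rightarrow> real" where
  "partial_deriv b f x = frechet_derivative f (at x) b"

primrec Ck :: "nat \<Rightarrow> ('a::euclidean_space \<Rightarrow> real) \<Rightarrow> bool" where
  "Ck 0 f \<longleftrightarrow> continuous_on UNIV f"
| "Ck (Suc k) f \<longleftrightarrow> (\<forall>x. f differentiable at x) \<and> (\<forall>b\<in>Basis. Ck k (partial_deriv b f))"

definition test_functions :: "'a::euclidean_space set \<Rightarrow> ('a \<Rightarrow> real) set" where
  "test_functions \<Omega> = {\<phi>. (\<forall>k. Ck k \<phi>) \<and>
     compact (closure {x. \<phi> x \<noteq> 0}) \<and> closure {x. \<phi> x \<noteq> 0} \<subseteq> \<Omega>}"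


section \<open>Sobolev spaces\<close>

text \<open>A function on \<open>\<Omega>\<close> is identified with its extension by zero, so that all spaces over
  \<open>\<Omega>\<close> are sets of elements of the type \<open>'a l2\<close>.\<close>

definition L2 :: "'a::euclidean_space set \<Rightarrow> 'a l2 set" where
  "L2 \<Omega> = {u. AE x in lborel. x \<notin> \<Omega> \<longrightarrow> rep_l2 u x = 0}"

definition is_weak_partial :: "'a::euclidean_space set \<Rightarrow> 'a \<Rightarrow> 'a l2 \<Rightarrow> 'a l2 \<Rightarrow> bool" where
  "is_weak_partial \<Omega> b u g \<longleftrightarrow> g \<in> L2 \<Omega> \<and>
     (\<forall>\<phi>\<in>test_functions \<Omega>. inner u (abs_l2 (partial_deriv b \<phi>)) = - inner g (abs_l2 \<phi>))"

definition weak_partial :: "'a::euclidean_space set \<Rightarrow> 'a \<Rightarrow> 'a l2 \<Rightarrow> 'a l2" where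
  "weak_partial \<Omega> b u = (THE g. is_weak_partial \<Omega> b u g)"

definition H1 :: "'a::euclidean_space set \<Rightarrow> 'a l2 set" where
  "H1 \<Omega> = {u \<in> L2 \<Omega>. \<forall>b\<in>Basis. \<exists>g. is_weak_partial \<Omega> b u g}"

definition grad_inner :: "'a::euclidean_space set \<Rightarrow> 'a l2 \<Rightarrow> 'a l2 \<Rightarrow> real" where
  "grad_inner \<Omega> u w = (\<Sum>b\<in>Basis. inner (weak_partial \<Omega> b u) (weak_partial \<Omega> b w))"

definition H1_norm :: "'a::euclidean_space set \<Rightarrow> 'a l2 \<Rightarrow> real" where
  "H1_norm \<Omega> u = sqrt (inner u u + grad_inner \<Omega> u u)"

definition H10 :: "'a::euclidean_space set \<Rightarrow> 'a l2 set" where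
  "H10 \<Omega> = {u \<in> H1 \<Omega>. \<forall>\<epsilon>>0. \<exists>\<phi>\<in>test_functions \<Omega>. H1_norm \<Omega> (u - abs_l2 \<phi>) < \<epsilon>}"

definition H10_norm :: "'a::euclidean_space set \<Rightarrow> 'a l2 \<Rightarrow> real" where
  "H10_norm \<Omega> u = sqrt (grad_inner \<Omega> u u)"

text \<open>Functionals on \<open>H10 \<Omega>\<close> are represented by functions on the whole type that vanish outside
  \<open>H10 \<Omega>\<close>, so that two functionals are equal iff they agree on \<open>H10 \<Omega>\<close>.\<close>

definition Hm1 :: "'a::euclidean_space set \<Rightarrow> ('a l2 \<Rightarrow> real) set" where
  "Hm1 \<Omega> = {F.
     (\<forall>u\<in>H10 \<Omega>. \<forall>w\<in>H10 \<Omega>. F (u + w) = F u + F w) \<and>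
     (\<forall>c. \<forall>u\<in>H10 \<Omega>. F (c *\<^sub>R u) = c * F u) \<and>
     (\<exists>C. \<forall>u\<in>H10 \<Omega>. \<bar>F u\<bar> \<le> C * H10_norm \<Omega> u) \<and>
     (\<forall>u. u \<notin> H10 \<Omega> \<longrightarrow> F u = 0)}"

definition Hm1_norm :: "'a::euclidean_space set \<Rightarrow> ('a l2 \<Rightarrow> real) \<Rightarrow> real" where
  "Hm1_norm \<Omega> F = (SUP u\<in>{u \<in> H10 \<Omega>. H10_norm \<Omega> u \<le> 1}. \<bar>F u\<bar>)"

definition bounded_linear_H10_Hm1 ::
    "'a::euclidean_space set \<Rightarrow> ('a l2 \<Rightarrow> 'a l2 \<Rightarrow> real) \<Rightarrow> bool" where
  "bounded_linear_H10_Hm1 \<Omega> G \<longleftrightarrow>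
     (\<forall>u\<in>H10 \<Omega>. G u \<in> Hm1 \<Omega>) \<and>
     (\<forall>u\<in>H10 \<Omega>. \<forall>w\<in>H10 \<Omega>. G (u + w) = (\<lambda>v. G u v + G w v)) \<and>
     (\<forall>c. \<forall>u\<in>H10 \<Omega>. G (c *\<^sub>R u) = (\<lambda>v. c * G u v)) \<and>
     (\<exists>C. \<forall>u\<in>H10 \<Omega>. Hm1_norm \<Omega> (G u) \<le> C * H10_norm \<Omega> u)"

text \<open>The library notion \<open>has_derivative\<close> is not applicable, because the norms on \<open>H10 \<Omega>\<close> and
  \<open>Hm1 \<Omega>\<close> are not norms of types.\<close>

definition has_frechet_derivative ::
    "'a::euclidean_space set \<Rightarrow> ('a l2 \<Rightarrow> 'a l2 \<Rightarrow> real) \<Rightarrow> ('a l2 \<Rightarrow> 'a l2 \<Rightarrow> real) \<Rightarrow> 'a l2 \<Rightarrow> bool" where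
  "has_frechet_derivative \<Omega> f f' u \<longleftrightarrow> bounded_linear_H10_Hm1 \<Omega> f' \<and>
     (\<forall>\<epsilon>>0. \<exists>\<delta>>0. \<forall>w\<in>H10 \<Omega>. H10_norm \<Omega> w < \<delta> \<longrightarrow>
        Hm1_norm \<Omega> (\<lambda>v. f (u + w) v - f u v - f' w v) \<le> \<epsilon> * H10_norm \<Omega> w)"


section \<open>The operators\<close>

text \<open>In the following, \<open>f'\<close> stands for the derivative of the nonlinearity at the given
  point of \<open>Vh\<close>.\<close>

definition weak_laplace :: "'a::euclidean_space set \<Rightarrow> 'a l2 \<Rightarrow> ('a l2 \<Rightarrow> real)" where
  "weak_laplace \<Omega> u = (\<lambda>v. if v \<in> H10 \<Omega> then grad_inner \<Omega> u v else 0)"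

definition inv_laplace :: "'a::euclidean_space set \<Rightarrow> ('a l2 \<Rightarrow> real) \<Rightarrow> 'a l2" where
  "inv_laplace \<Omega> = inv_into (H10 \<Omega>) (weak_laplace \<Omega>)"

definition ritz :: "'a::euclidean_space set \<Rightarrow> 'a l2 set \<Rightarrow> 'a l2 \<Rightarrow> 'a l2" where
  "ritz \<Omega> Vh u = (THE w. w \<in> Vh \<and> (\<forall>v\<in>Vh. grad_inner \<Omega> (u - w) v = 0))"

definition Vperp :: "'a::euclidean_space set \<Rightarrow> 'a l2 set \<Rightarrow> 'a l2 set" where
  "Vperp \<Omega> Vh = {u \<in> H10 \<Omega>. \<forall>v\<in>Vh. grad_inner \<Omega> u v = 0}"

definition Ah_inv :: "'a::euclidean_space set \<Rightarrow> 'a l2 set \<Rightarrow> ('a l2 \<Rightarrow> real) \<Rightarrow> 'a l2" where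
  "Ah_inv \<Omega> Vh g = ritz \<Omega> Vh (inv_laplace \<Omega> g)"

definition Aperp_inv :: "'a::euclidean_space set \<Rightarrow> 'a l2 set \<Rightarrow> ('a l2 \<Rightarrow> real) \<Rightarrow> 'a l2" where
  "Aperp_inv \<Omega> Vh g = inv_laplace \<Omega> g - ritz \<Omega> Vh (inv_laplace \<Omega> g)"

definition L_op :: "'a::euclidean_space set \<Rightarrow> ('a l2 \<Rightarrow> 'a l2 \<Rightarrow> real) \<Rightarrow> 'a l2 \<Rightarrow> ('a l2 \<Rightarrow> real)" where
  "L_op \<Omega> f' u = (\<lambda>v. weak_laplace \<Omega> u v - f' u v)"

definition T_op :: "'a::euclidean_space set \<Rightarrow> 'a l2 set \<Rightarrow> ('a l2 \<Rightarrow> 'a l2 \<Rightarrow> real) \<Rightarrow> 'a l2 \<Rightarrow> 'a l2" where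
  "T_op \<Omega> Vh f' u = ritz \<Omega> Vh (inv_laplace \<Omega> (L_op \<Omega> f' u))"

definition T_inv :: "'a::euclidean_space set \<Rightarrow> 'a l2 set \<Rightarrow> ('a l2 \<Rightarrow> 'a l2 \<Rightarrow> real) \<Rightarrow> 'a l2 \<Rightarrow> 'a l2" where
  "T_inv \<Omega> Vh f' = inv_into Vh (T_op \<Omega> Vh f')"

definition S_op :: "'a::euclidean_space set \<Rightarrow> 'a l2 set \<Rightarrow> ('a l2 \<Rightarrow> 'a l2 \<Rightarrow> real) \<Rightarrow> 'a l2 \<Rightarrow> 'a l2" where
  "S_op \<Omega> Vh f' y = y - Aperp_inv \<Omega> Vh (f' y)
     - Aperp_inv \<Omega> Vh (f' (T_inv \<Omega> Vh f' (Ah_inv \<Omega> Vh (f' y))))"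

definition S_inv :: "'a::euclidean_space set \<Rightarrow> 'a l2 set \<Rightarrow> ('a l2 \<Rightarrow> 'a l2 \<Rightarrow> real) \<Rightarrow> 'a l2 \<Rightarrow> 'a l2" where
  "S_inv \<Omega> Vh f' = inv_into (Vperp \<Omega> Vh) (S_op \<Omega> Vh f')"

definition block_op ::
    "('b \<Rightarrow> 'b) \<Rightarrow> ('b \<Rightarrow> 'b) \<Rightarrow> ('b \<Rightarrow> 'b) \<Rightarrow> ('b \<Rightarrow> 'b) \<Rightarrow> 'b \<times> 'b \<Rightarrow> 'b \<times> ('b::plus)" where
  "block_op A B C D = (\<lambda>(x, y). (A x + B y, C x + D y))"

definition D_op ::
    "'a::euclidean_space set \<Rightarrow> 'a l2 set \<Rightarrow> ('a l2 \<Rightarrow> 'a l2 \<Rightarrow> real) \<Rightarrow> 'a l2 \<times> 'a l2 \<Rightarrow> 'a l2 \<times> 'a l2" where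
  "D_op \<Omega> Vh f' = block_op
     (T_op \<Omega> Vh f')                     (\<lambda>y. - Ah_inv \<Omega> Vh (f' y))
     (\<lambda>x. - Aperp_inv \<Omega> Vh (f' x))      (\<lambda>y. y - Aperp_inv \<Omega> Vh (f' y))"

end

theory Submission
  imports Defs
begin

text \<open>Two observations carry the theorem. Write \<open>A\<close> for the weak Laplace operator and \<open>R\<close> for the Ritz projection.

First, \<open>D\<close> is a \<open>2 \<times> 2\<close> block operator whose upper left entry \<open>T\<close> is invertible, and \<open>S\<close> is exactly its Schur
complement. Block elimination therefore shows that \<open>D\<close> is bijective and yields the stated formula for its inverse
(\<open>block_elimination\<close>). This is pure algebra.

Second, \<open>L = A (I - A\<^sup>-\<^sup>1 f')\<close>, and \<open>D\<close> is the operator \<open>I - A\<^sup>-\<^sup>1 f'\<close> in the coordinates given by the orthogonal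
decomposition of \<open>H10\<close> into \<open>Vh\<close> and its complement (\<open>D_op_eq\<close>). Since \<open>A\<close> is a bijection of \<open>H10\<close> with
\<open>Hm1\<close>, the bijectivity of \<open>D\<close> implies that of \<open>L\<close> (\<open>bij_L_op\<close>).

What remains is the analysis that makes these objects meaningful. The map \<open>R\<close> exists because \<open>Vh\<close> is finite-dimensional
(\<open>projection_exists\<close>). That \<open>A\<close> is bijective is the Riesz representation theorem for the gradient inner product
(\<open>Riesz_representation\<close>, \<open>bij_weak_laplace\<close>). It needs that this is an inner product on \<open>H10\<close>, for which the norm is
complete. The ingredients are the completeness of L2 (\<open>Cauchy_l2_convergent\<close>), the uniqueness of weak derivatives, which
follows from the fundamental lemma of the calculus of variations (\<open>fundamental_lemma\<close>), and the Poincare inequality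
(\<open>Poincare_inequality\<close>), which is obtained from integration by parts for test functions (\<open>integration_by_parts\<close>).\<close>


section \<open>Inversion of a block operator by its Schur complement\<close>

lemma inv_into_additive:
  fixes f :: "'b::ab_group_add \<Rightarrow> 'b"
  assumes f: "bij_betw f X X" and X: "\<And>x y. x \<in> X \<Longrightarrow> y \<in> X \<Longrightarrow> x + y \<in> X"
    and f_add: "\<And>x y. x \<in> X \<Longrightarrow> y \<in> X \<Longrightarrow> f (x + y) = f x + f y"
    and xy: "x \<in> X" "y \<in> X"
  shows "inv_into X f (x + y) = inv_into X f x + inv_into X f y"
proof -
  have in_X: "inv_into X f z \<in> X" if "z \<in> X" for z
    using bij_betw_apply[OF bij_betw_inv_into[OF f] that] .
  have "f (inv_into X f x + inv_into X f y) = x + y"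
    using xy by (simp add: f_add in_X bij_betw_inv_into_right[OF f])
  then show ?thesis
    using bij_betw_inv_into_left[OF f X[OF in_X[OF xy(1)] in_X[OF xy(2)]]] by simp
qed

text \<open>With \<open>T\<close> invertible, the first row \<open>T x - B y = p\<close> says \<open>x = T'(p + B y)\<close>. Substituting this into the second
row \<open>E y - C x = q\<close> and using additivity turns it into an equation for \<open>y\<close> alone, \<open>S y = q + C (T' p)\<close>, where
\<open>S = E - C T' B\<close> is the Schur complement. So \<open>S\<close> decides about solvability, and expanding
\<open>y = S'(q + C (T' p))\<close> and \<open>x = T'(p + B y)\<close> by additivity gives the four entries of the inverse matrix. All maps
live on carriers inside one type, so that the sets \<open>X\<close> and \<open>Y\<close> can be complementary subspaces.\<close>

theorem block_elimination:
  fixes X Y :: "'b::ab_group_add set"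
  assumes X: "\<And>x x'. x \<in> X \<Longrightarrow> x' \<in> X \<Longrightarrow> x + x' \<in> X" "\<And>x x'. x \<in> X \<Longrightarrow> x' \<in> X \<Longrightarrow> x - x' \<in> X"
    and Y: "\<And>y y'. y \<in> Y \<Longrightarrow> y' \<in> Y \<Longrightarrow> y + y' \<in> Y" "\<And>y y'. y \<in> Y \<Longrightarrow> y' \<in> Y \<Longrightarrow> y - y' \<in> Y"
    and B: "\<And>y. y \<in> Y \<Longrightarrow> B y \<in> X" and C: "\<And>x. x \<in> X \<Longrightarrow> C x \<in> Y" and E: "\<And>y. y \<in> Y \<Longrightarrow> E y \<in> Y"
    and T_add: "\<And>x x'. x \<in> X \<Longrightarrow> x' \<in> X \<Longrightarrow> T (x + x') = T x + T x'"
    and B_add: "\<And>y y'. y \<in> Y \<Longrightarrow> y' \<in> Y \<Longrightarrow> B (y + y') = B y + B y'"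
    and C_add: "\<And>x x'. x \<in> X \<Longrightarrow> x' \<in> X \<Longrightarrow> C (x + x') = C x + C x'"
    and E_add: "\<And>y y'. y \<in> Y \<Longrightarrow> y' \<in> Y \<Longrightarrow> E (y + y') = E y + E y'"
    and T: "bij_betw T X X" and S: "bij_betw (\<lambda>y. E y - C (inv_into X T (B y))) Y Y"
  defines "D \<equiv> block_op T (\<lambda>y. - B y) (\<lambda>x. - C x) E"
    and "T' \<equiv> inv_into X T" and "S' \<equiv> inv_into Y (\<lambda>y. E y - C (inv_into X T (B y)))"
  shows block_op_bij: "bij_betw D (X \<times> Y) (X \<times> Y)"
    and block_op_solution: "\<And>x y p q. x \<in> X \<Longrightarrow> y \<in> Y \<Longrightarrow> p \<in> X \<Longrightarrow> q \<in> Y \<Longrightarrow> D (x, y) = (p, q) \<Longrightarrow>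
      (x, y) = block_op (\<lambda>x. T' x + T' (B (S' (C (T' x))))) (\<lambda>y. T' (B (S' y)))
        (\<lambda>x. S' (C (T' x))) S' (p, q)"
proof -
  have T'_in: "T' z \<in> X" and T_T': "T (T' z) = z" and T'_T: "T' (T z) = z" and T_in: "T z \<in> X"
    if "z \<in> X" for z
    using that T bij_betw_inv_into_left[OF T] bij_betw_inv_into_right[OF T]
      bij_betw_apply[OF bij_betw_inv_into[OF T]]
    by (auto simp: T'_def bij_betw_apply)
  have T'_add: "T' (u + v) = T' u + T' v" if "u \<in> X" "v \<in> X" for u v
    unfolding T'_def using inv_into_additive[OF T X(1) T_add that] .
  have S'_in: "S' z \<in> Y" if "z \<in> Y" for z
    using bij_betw_apply[OF bij_betw_inv_into[OF S] that] by (simp add: S'_def)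
  have S'_add: "S' (u + v) = S' u + S' v" if "u \<in> Y" "v \<in> Y" for u v
    unfolding S'_def
    by (rule inv_into_additive[OF S Y(1) _ that])
      (auto simp: E_add B_add B C_add T'_in T'_add simp flip: T'_def)
  have S_iff: "E y - C (T' (B y)) = z \<longleftrightarrow> y = S' z" if "z \<in> Y" "y \<in> Y" for y z
    using bij_betw_inv_into_left[OF S \<open>y \<in> Y\<close>] bij_betw_inv_into_right[OF S \<open>z \<in> Y\<close>]
    unfolding S'_def T'_def by auto
  have D_iff: "D (x, y) = (p, q) \<longleftrightarrow> y = S' (q + C (T' p)) \<and> x = T' (p + B y)"
    if in_XY: "x \<in> X" "y \<in> Y" "p \<in> X" "q \<in> Y" for x y p q
  proof -
    have 1: "T x - B y = p \<longleftrightarrow> x = T' (p + B y)"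
      using T'_T[OF in_XY(1)] T_T'[OF X(1)[OF in_XY(3) B[OF in_XY(2)]]] by (auto simp: algebra_simps)
    have 2: "E y - C (T' (p + B y)) = q \<longleftrightarrow> y = S' (q + C (T' p))"
      using in_XY
      by (subst S_iff[symmetric]) (auto simp: T'_add B C_add T'_in C Y algebra_simps)
    show ?thesis using 1 2 by (auto simp: D_def block_op_def)
  qed
  have D_in: "D z \<in> X \<times> Y" if "z \<in> X \<times> Y" for z
    using that X(2)[OF T_in B] Y(2)[OF E C] by (auto simp: D_def block_op_def)
  show "bij_betw D (X \<times> Y) (X \<times> Y)"
  proof (rule bij_betw_byWitness[where f' = "\<lambda>(p, q). (T' (p + B (S' (q + C (T' p)))), S' (q + C (T' p)))"])
    let ?D' = "\<lambda>(p, q). (T' (p + B (S' (q + C (T' p)))), S' (q + C (T' p)))"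
    have D'_in: "?D' z \<in> X \<times> Y" if "z \<in> X \<times> Y" for z
      using that by (auto intro!: T'_in S'_in X Y B C)
    show "\<forall>z\<in>X \<times> Y. ?D' (D z) = z"
    proof
      fix z assume z: "z \<in> X \<times> Y"
      obtain x y where xy: "z = (x, y)" "x \<in> X" "y \<in> Y" using z by auto
      obtain p q where pq: "D z = (p, q)" "p \<in> X" "q \<in> Y" using D_in[OF z] by auto
      have "y = S' (q + C (T' p)) \<and> x = T' (p + B y)"
        using D_iff[OF xy(2,3) pq(2,3)] pq(1) xy(1) by simp
      then show "?D' (D z) = z" unfolding pq(1) using xy(1) by simp
    qed
    show "\<forall>z\<in>X \<times> Y. D (?D' z) = z"
    proof
      fix z assume z: "z \<in> X \<times> Y"
      obtain p q where pq: "z = (p, q)" "p \<in> X" "q \<in> Y" using z by auto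
      show "D (?D' z) = z" using D_iff[OF _ _ pq(2,3)] D'_in[OF z] by (simp add: pq(1))
    qed
    show "D ` (X \<times> Y) \<subseteq> X \<times> Y" "?D' ` (X \<times> Y) \<subseteq> X \<times> Y" using D_in D'_in by blast+
  qed
  fix x y p q
  assume in_XY: "x \<in> X" "y \<in> Y" "p \<in> X" "q \<in> Y" and D: "D (x, y) = (p, q)"
  have "y = S' (q + C (T' p))" "x = T' (p + B y)" using D_iff[OF in_XY] D by auto
  moreover have "S' (q + C (T' p)) = S' (C (T' p)) + S' q"
    using in_XY by (simp add: S'_add C T'_in)
  moreover have "T' (p + B (S' (C (T' p)) + S' q)) = T' p + T' (B (S' (C (T' p)))) + T' (B (S' q))"
    using in_XY by (simp add: T'_add B_add S'_in B C T'_in X)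
  ultimately show "(x, y) = block_op (\<lambda>x. T' x + T' (B (S' (C (T' x))))) (\<lambda>y. T' (B (S' y)))
        (\<lambda>x. S' (C (T' x))) S' (p, q)"
    by (simp add: block_op_def)
qed


section \<open>Projection and Riesz representation on a subspace\<close>

text \<open>The energy space \<open>H10\<close> is a subset of the type \<open>'a l2\<close> and depends on the domain, and its inner product is not the one
of the type. The Hilbert space arguments are therefore carried out for an inner product \<open>a\<close> on a subspace
\<open>V\<close>.\<close>

locale form_on_subspace =
  fixes V :: "'v::real_vector set" and a :: "'v \<Rightarrow> 'v \<Rightarrow> real"
  assumes V: "subspace V"
    and add_left: "\<And>x y z. x \<in> V \<Longrightarrow> y \<in> V \<Longrightarrow> z \<in> V \<Longrightarrow> a (x + y) z = a x z + a y z"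
    and scale_left: "\<And>c x z. x \<in> V \<Longrightarrow> z \<in> V \<Longrightarrow> a (c *\<^sub>R x) z = c * a x z"
    and sym: "\<And>x y. x \<in> V \<Longrightarrow> y \<in> V \<Longrightarrow> a x y = a y x"
    and nonneg: "\<And>x. x \<in> V \<Longrightarrow> 0 \<le> a x x"
    and definite: "\<And>x. x \<in> V \<Longrightarrow> a x x = 0 \<Longrightarrow> x = 0"
begin

lemma closed_ops [simp]: "0 \<in> V" "x \<in> V \<Longrightarrow> y \<in> V \<Longrightarrow> x + y \<in> V"
    "x \<in> V \<Longrightarrow> y \<in> V \<Longrightarrow> x - y \<in> V" "x \<in> V \<Longrightarrow> c *\<^sub>R x \<in> V"
  using V by (auto intro: subspace_0 subspace_add subspace_diff subspace_scale)

lemma diff_left: "x \<in> V \<Longrightarrow> y \<in> V \<Longrightarrow> z \<in> V \<Longrightarrow> a (x - y) z = a x z - a y z"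
  using add_left[of x "(-1) *\<^sub>R y" z] scale_left[of y z "-1"] closed_ops(4)[of y "-1"] by simp

lemma zero_left [simp]: "z \<in> V \<Longrightarrow> a 0 z = 0"
  using scale_left[of 0 z 0] by simp

lemma zero_right [simp]: "z \<in> V \<Longrightarrow> a z 0 = 0"
  using sym[of z 0] by simp

lemma add_right: "x \<in> V \<Longrightarrow> y \<in> V \<Longrightarrow> z \<in> V \<Longrightarrow> a z (x + y) = a z x + a z y"
  by (simp add: sym[of z] add_left)

lemma scale_right: "x \<in> V \<Longrightarrow> z \<in> V \<Longrightarrow> a z (c *\<^sub>R x) = c * a z x"
  by (simp add: sym[of z] scale_left)

lemma diff_right: "x \<in> V \<Longrightarrow> y \<in> V \<Longrightarrow> z \<in> V \<Longrightarrow> a z (x - y) = a z x - a z y"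
  by (simp add: sym[of z] diff_left)

lemmas form_simps = add_left add_right scale_left scale_right diff_left diff_right

lemma Cauchy_Schwarz:
  assumes "x \<in> V" "y \<in> V"
  shows "(a x y)\<^sup>2 \<le> a x x * a y y"
proof (cases "a y y = 0")
  case True
  then show ?thesis using definite[of y] assms by simp
next
  case False
  then have pos: "a y y > 0" using nonneg[of y] assms by simp
  define t where "t = a x y / a y y"
  have "0 \<le> a (x - t *\<^sub>R y) (x - t *\<^sub>R y)" using assms nonneg by simp
  also have "\<dots> = a x x - 2 * t * a x y + t\<^sup>2 * a y y"
    using assms sym[of x y] by (simp add: form_simps power2_eq_square algebra_simps)
  also have "\<dots> = a x x - (a x y)\<^sup>2 / a y y"
    using pos by (simp add: t_def power2_eq_square field_simps)
  finally show ?thesis using pos by (simp add: field_simps)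
qed

lemma abs_form_le:
  assumes "x \<in> V" "y \<in> V"
  shows "\<bar>a x y\<bar> \<le> sqrt (a x x) * sqrt (a y y)"
  using real_sqrt_le_mono[OF Cauchy_Schwarz[OF assms]] by (simp add: real_sqrt_mult)

lemma form_norm_triangle:
  assumes "x \<in> V" "y \<in> V"
  shows "sqrt (a (x + y) (x + y)) \<le> sqrt (a x x) + sqrt (a y y)"
proof (rule real_le_lsqrt)
  have "a (x + y) (x + y) = a x x + 2 * a x y + a y y"
    using assms sym[of x y] by (simp add: form_simps)
  also have "\<dots> \<le> (sqrt (a x x))\<^sup>2 + 2 * (sqrt (a x x) * sqrt (a y y)) + (sqrt (a y y))\<^sup>2"
    using abs_form_le[OF assms] nonneg assms by simp
  also have "\<dots> = (sqrt (a x x) + sqrt (a y y))\<^sup>2" by (simp add: power2_sum)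
  finally show "a (x + y) (x + y) \<le> (sqrt (a x x) + sqrt (a y y))\<^sup>2" .
qed (use assms nonneg in auto)

lemma form_norm_scale: "x \<in> V \<Longrightarrow> sqrt (a (c *\<^sub>R x) (c *\<^sub>R x)) = \<bar>c\<bar> * sqrt (a x x)"
  by (simp add: form_simps real_sqrt_mult flip: mult.assoc)

lemma eq_if_form_eq:
  assumes "x \<in> V" "y \<in> V" "\<And>v. v \<in> V \<Longrightarrow> a x v = a y v"
  shows "x = y"
  using definite[of "x - y"] assms by (simp add: form_simps)

text \<open>Gram-Schmidt: the new generator \<open>b\<close> is replaced by its component \<open>e\<close> orthogonal to the old span, and the projection
changes only by the component along \<open>e\<close>. If \<open>b\<close> depends on the old generators, then \<open>e = 0\<close> and the correction
vanishes, since its coefficient is multiplied by \<open>0\<close>.\<close>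

lemma projection_exists:
  assumes "finite B" "B \<subseteq> V" "x \<in> V"
  shows "\<exists>p\<in>span B. \<forall>v\<in>span B. a (x - p) v = 0"
  using assms
proof (induction B arbitrary: x rule: finite_induct)
  case empty
  then show ?case by auto
next
  case (insert b B)
  have span_V: "span B \<subseteq> V" using insert.prems V by (simp add: span_minimal)
  obtain q where q: "q \<in> span B" "\<forall>v\<in>span B. a (b - q) v = 0"
    using insert.IH[of b] insert.prems by auto
  obtain r where r: "r \<in> span B" "\<forall>v\<in>span B. a (x - r) v = 0"
    using insert.IH[of x] insert.prems by auto
  define e where "e = b - q"
  define p where "p = r + (a x e / a e e) *\<^sub>R e"
  have bV: "b \<in> V" and qV: "q \<in> V" and rV: "r \<in> V" and xV: "x \<in> V" and eV: "e \<in> V"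
    using insert.prems q r span_V by (auto simp: e_def)
  have sub: "span B \<subseteq> span (insert b B)" by (simp add: span_mono subset_insertI)
  have e_span: "e \<in> span (insert b B)"
    unfolding e_def using q sub by (intro span_diff) (auto intro: span_base)
  have e_B: "a e v = 0" "a v e = 0" if "v \<in> span B" for v
    using q that span_V sym[of e v] eV by (auto simp: e_def)
  have "a (x - p) v = 0" if v: "v \<in> span (insert b B)" for v
  proof -
    obtain k where k: "v - k *\<^sub>R b \<in> span B" using v span_breakdown_eq by blast
    define w where "w = v - k *\<^sub>R b + k *\<^sub>R q"
    have w: "w \<in> span B" unfolding w_def using k q by (intro span_add span_scale)
    have v_eq: "v = w + k *\<^sub>R e" by (simp add: w_def e_def algebra_simps)
    have wV: "w \<in> V" using w span_V by auto
    have "a (x - p) w = 0"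
      using r(2) w e_B[OF w] wV xV rV eV by (auto simp: p_def form_simps)
    moreover have "a (x - p) e = 0"
    proof (cases "e = 0")
      case True
      then show ?thesis using xV rV by (simp add: p_def)
    next
      case False
      then have "a e e \<noteq> 0" using definite eV by blast
      then show ?thesis using e_B[OF r(1)] xV rV eV by (simp add: p_def form_simps)
    qed
    moreover have "x - p \<in> V" using xV rV eV by (simp add: p_def)
    ultimately show ?thesis using wV eV by (simp add: v_eq form_simps)
  qed
  moreover have "p \<in> span (insert b B)"
    unfolding p_def using r sub e_span by (intro span_add span_scale) auto
  ultimately show ?case by blast
qed

text \<open>The representing vector minimizes \<open>J v = a v v - 2 F v\<close>, which is bounded below because \<open>F\<close> is bounded. The limit of a
minimizing sequence satisfies the Euler equation \<open>a u v = F v\<close>.\<close>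

theorem Riesz_representation:
  assumes complete: "\<And>X. (\<And>n. X n \<in> V) \<Longrightarrow>
        (\<And>e. e > 0 \<Longrightarrow> \<exists>N. \<forall>m\<ge>N. \<forall>n\<ge>N. a (X m - X n) (X m - X n) < e) \<Longrightarrow>
        \<exists>x\<in>V. (\<lambda>n::nat. a (X n - x) (X n - x)) \<longlonglongrightarrow> 0"
    and F_add: "\<And>x y. x \<in> V \<Longrightarrow> y \<in> V \<Longrightarrow> F (x + y) = F x + F y"
    and F_scale: "\<And>c x. x \<in> V \<Longrightarrow> F (c *\<^sub>R x) = c * F x"
    and F_bound: "\<And>x. x \<in> V \<Longrightarrow> \<bar>F x\<bar> \<le> C * sqrt (a x x)"
  shows "\<exists>u\<in>V. \<forall>v\<in>V. a u v = F v"
proof -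
  define J where "J v = a v v - 2 * F v" for v
  define d where "d = Inf (J ` V)"
  have "- C\<^sup>2 \<le> J v" if "v \<in> V" for v
  proof -
    have "0 \<le> (sqrt (a v v) - C)\<^sup>2" by simp
    also have "\<dots> = a v v - 2 * (C * sqrt (a v v)) + C\<^sup>2"
      using nonneg[OF that] by (simp add: power2_diff)
    finally show ?thesis using F_bound[OF that] by (simp add: J_def)
  qed
  then have bdd: "bdd_below (J ` V)" by (auto simp: bdd_below_def)
  have d_le: "d \<le> J v" if "v \<in> V" for v
    unfolding d_def using bdd that by (simp add: cINF_lower)
  have "\<exists>v\<in>V. J v < d + 1 / Suc n" for n
  proof (rule ccontr)
    assume "\<not> ?thesis"
    then have "d + 1 / Suc n \<le> d" unfolding d_def using closed_ops(1)
      by (intro cINF_greatest) (auto simp: not_less d_def simp del: closed_ops(1))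
    then show False by simp
  qed
  then obtain X where X: "\<And>n. X n \<in> V" "\<And>n. J (X n) < d + 1 / Suc n" by metis
  have F_half: "F ((1/2) *\<^sub>R (x + y)) = (F x + F y) / 2" if "x \<in> V" "y \<in> V" for x y
    using that by (simp add: F_scale F_add del: scaleR_add_right)
  \<comment> \<open>The parallelogram identity compares \<open>J\<close> at two members with \<open>J\<close> at their midpoint, which is at
    least \<open>d\<close>. Hence a minimizing sequence is a Cauchy sequence.\<close>
  have close: "a (X m - X n) (X m - X n) < 2 / Suc m + 2 / Suc n" for m n
  proof -
    define w where "w = (1/2) *\<^sub>R (X m + X n)"
    have "w \<in> V" using X(1) by (simp add: w_def)
    have F_w: "F w = (F (X m) + F (X n)) / 2" unfolding w_def by (rule F_half[OF X(1) X(1)])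
    have a_w: "a w w = (a (X m) (X m) + 2 * a (X m) (X n) + a (X n) (X n)) / 4"
      using X(1) sym[of "X n" "X m"] by (simp add: w_def form_simps field_simps)
    have "a (X m - X n) (X m - X n) = a (X m) (X m) - 2 * a (X m) (X n) + a (X n) (X n)"
      using X(1) sym[of "X n" "X m"] by (simp add: form_simps)
    also have "\<dots> = 2 * J (X m) + 2 * J (X n) - 4 * J w"
      unfolding J_def F_w a_w by (simp add: field_simps)
    also have "\<dots> < 2 / Suc m + 2 / Suc n"
      using X(2)[of m] X(2)[of n] d_le[OF \<open>w \<in> V\<close>] by simp
    finally show ?thesis .
  qed
  have "\<exists>N. \<forall>m\<ge>N. \<forall>n\<ge>N. a (X m - X n) (X m - X n) < e" if "e > 0" for e
  proof -
    obtain N where N: "1 / real (Suc N) < e / 4"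
      using reals_Archimedean[of "e / 4"] \<open>e > 0\<close> by (auto simp: inverse_eq_divide)
    have "a (X m - X n) (X m - X n) < e" if "N \<le> m" "N \<le> n" for m n
    proof -
      have "1 / real (Suc m) \<le> 1 / real (Suc N)" "1 / real (Suc n) \<le> 1 / real (Suc N)"
        using that by (auto simp: frac_le)
      then show ?thesis using close[of m n] N by simp
    qed
    then show ?thesis by blast
  qed
  then obtain u where u: "u \<in> V" and lim: "(\<lambda>n. a (X n - u) (X n - u)) \<longlonglongrightarrow> 0"
    using complete[of X] X(1) by blast
  have "a u v = F v" if v: "v \<in> V" for v
  proof -
    have "(\<lambda>n. sqrt (a (X n - u) (X n - u)) * sqrt (a v v)) \<longlonglongrightarrow> 0"
      using tendsto_mult_left_zero[OF tendsto_real_sqrt[OF lim, simplified]] by simp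
    then have "(\<lambda>n. a (X n - u) v) \<longlonglongrightarrow> 0"
      by (rule Lim_null_comparison[rotated]) (use abs_form_le X(1) u v in auto)
    then have "(\<lambda>n. a (X n - u) v + a u v) \<longlonglongrightarrow> 0 + a u v" by (intro tendsto_intros)
    then have lim_v: "(\<lambda>n. a (X n) v) \<longlonglongrightarrow> a u v" using X(1) u v by (simp add: form_simps)
    define s where "s = a u v - F v"
    \<comment> \<open>First variation: \<open>J\<close> at \<open>X n + t v\<close> cannot be smaller than \<open>d\<close>, and \<open>J\<close> at \<open>X n\<close> tends to \<open>d\<close>. This
      avoids the continuity of \<open>J\<close>.\<close>
    have "0 \<le> 2 * t * s + t\<^sup>2 * a v v" for t
    proof (rule LIMSEQ_le)
      show "(\<lambda>n. - (1 / real (Suc n))) \<longlonglongrightarrow> 0"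
        using tendsto_minus[OF lim_1_over_n[THEN LIMSEQ_Suc]] by simp
      show "(\<lambda>n. 2 * t * (a (X n) v - F v) + t\<^sup>2 * a v v) \<longlonglongrightarrow> 2 * t * s + t\<^sup>2 * a v v"
        unfolding s_def by (intro tendsto_intros lim_v)
      have "- (1 / real (Suc n)) \<le> 2 * t * (a (X n) v - F v) + t\<^sup>2 * a v v" for n
      proof -
        have "J (X n + t *\<^sub>R v) = J (X n) + 2 * t * (a (X n) v - F v) + t\<^sup>2 * a v v"
          using X(1)[of n] v sym[of v "X n"] unfolding J_def
          by (simp add: form_simps F_add F_scale power2_eq_square algebra_simps)
        then show ?thesis using d_le[of "X n + t *\<^sub>R v"] X[of n] v by simp
      qed
      then show "\<exists>N. \<forall>n\<ge>N. - (1 / real (Suc n)) \<le> 2 * t * (a (X n) v - F v) + t\<^sup>2 * a v v"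
        by blast
    qed
    note quadratic = this
    \<comment> \<open>The choice \<open>t = - s / (a v v + 1)\<close> makes the quadratic negative unless \<open>s = 0\<close>; adding \<open>1\<close> keeps the
      denominator positive also for \<open>v = 0\<close>.\<close>
    define r where "r = s / (a v v + 1)"
    have s_r: "s = r * (a v v + 1)" using nonneg[OF v] by (simp add: r_def)
    have "0 \<le> - (r\<^sup>2 * (a v v + 2))"
      using quadratic[of "- r"] unfolding s_r by (simp add: algebra_simps power2_eq_square)
    then have "r\<^sup>2 \<le> 0" using nonneg[OF v] by (auto simp: mult_le_0_iff)
    then have "s = 0" by (simp add: s_r)
    then show ?thesis by (simp add: s_def)
  qed
  then show ?thesis using u by blast
qed

end


section \<open>Completeness of L2\<close>

lemma sq_integrable_rep: "sq_integrable (rep_l2 u)"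
  using Quotient_l2 by (metis Quotient_rep_reflp l2_rel_def)

lemma borel_measurable_rep [measurable]:
  fixes u :: "'a::euclidean_space l2"
  shows "rep_l2 u \<in> borel_measurable borel"
  using sq_integrable_rep[of u] by (simp add: sq_integrable_def)

lemma abs_rep [simp]: "abs_l2 (rep_l2 (u :: 'a::euclidean_space l2)) = u"
  using Quotient_l2 by (metis Quotient_abs_rep)

lemma rep_abs: "sq_integrable f \<Longrightarrow> AE x in lborel. rep_l2 (abs_l2 f) x = f x"
  using Quotient_rep_abs[OF Quotient_l2, of f] by (simp add: l2_rel_def)

lemma abs_l2_eqI:
  "sq_integrable f \<Longrightarrow> sq_integrable g \<Longrightarrow> (AE x in lborel. f x = g x) \<Longrightarrow> abs_l2 f = abs_l2 g"
  using Quotient_rel_abs[OF Quotient_l2, of f g] by (simp add: l2_rel_def)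

lemma inner_abs:
  "sq_integrable f \<Longrightarrow> sq_integrable g \<Longrightarrow> inner (abs_l2 f) (abs_l2 g) = (\<integral>x. f x * g x \<partial>lborel)"
  by (simp add: inner_l2.abs_eq l2_rel_def)

lemma inner_rep_abs: "sq_integrable g \<Longrightarrow> inner u (abs_l2 g) = (\<integral>x. rep_l2 u x * g x \<partial>lborel)"
  using inner_abs[OF sq_integrable_rep, of g u] by simp

lemma abs_l2_add:
  "sq_integrable f \<Longrightarrow> sq_integrable g \<Longrightarrow> abs_l2 (\<lambda>x. f x + g x) = abs_l2 f + abs_l2 g"
  by (simp add: plus_l2.abs_eq l2_rel_def)

lemma abs_l2_scale: "sq_integrable f \<Longrightarrow> abs_l2 (\<lambda>x. c * f x) = c *\<^sub>R abs_l2 f"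
  by (simp add: scaleR_l2.abs_eq l2_rel_def)

lemma sq_integrable_diff:
  assumes "sq_integrable f" "sq_integrable g"
  shows "sq_integrable (\<lambda>x. f x - g x)"
  using sq_integrable_add[OF assms(1) sq_integrable_scale[OF assms(2), of "-1"]] by simp

lemma abs_l2_diff:
  assumes "sq_integrable f" "sq_integrable g"
  shows "abs_l2 (\<lambda>x. f x - g x) = abs_l2 f - abs_l2 g"
  using abs_l2_add[OF assms(1) sq_integrable_scale[OF assms(2), of "-1"]]
    abs_l2_scale[OF assms(2), of "-1"] by simp

lemma nn_integral_sq_diff:
  assumes "sq_integrable f" "sq_integrable g"
  shows "(\<integral>\<^sup>+x. ennreal ((f x - g x)\<^sup>2) \<partial>lborel) = ennreal ((norm (abs_l2 f - abs_l2 g))\<^sup>2)"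
proof -
  have "sq_integrable (\<lambda>x. f x - g x)" using assms by (rule sq_integrable_diff)
  then have "(\<integral>\<^sup>+x. ennreal ((f x - g x)\<^sup>2) \<partial>lborel) = ennreal (\<integral>x. (f x - g x)\<^sup>2 \<partial>lborel)"
    by (intro nn_integral_eq_integral) (auto simp: sq_integrable_def)
  also have "(\<integral>x. (f x - g x)\<^sup>2 \<partial>lborel) = (norm (abs_l2 f - abs_l2 g))\<^sup>2"
    using \<open>sq_integrable (\<lambda>x. f x - g x)\<close> assms
    by (simp add: abs_l2_diff[symmetric] power2_norm_eq_inner inner_abs)
      (simp add: power2_eq_square)
  finally show ?thesis .
qed

text \<open>The weights \<open>4 ^ k\<close> are chosen so that the integrals of \<open>4 ^ k * (d k)\<^sup>2\<close>, where \<open>d k\<close> is the \<open>k\<close>-th increment, are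
summable. Almost everywhere the weighted series is then finite, so that its terms are bounded, which makes the increments
decay like \<open>(1/2) ^ k\<close>.\<close>

lemma fast_Cauchy_convergent_AE:
  fixes u :: "nat \<Rightarrow> 'a::euclidean_space l2"
  assumes fast: "\<And>k. (norm (u (Suc k) - u k))\<^sup>2 \<le> (1/8) ^ k"
  shows "AE x in lborel. convergent (\<lambda>k. rep_l2 (u k) x)"
proof -
  define d where "d k x = rep_l2 (u (Suc k)) x - rep_l2 (u k) x" for k x
  have [measurable]: "d k \<in> borel_measurable lborel" for k
    unfolding d_def by measurable
  have "(\<integral>\<^sup>+x. ennreal (4 ^ k * (d k x)\<^sup>2) \<partial>lborel) \<le> ennreal ((1/2) ^ k)" for k
  proof -
    have "(\<integral>\<^sup>+x. ennreal (4 ^ k * (d k x)\<^sup>2) \<partial>lborel) = ennreal (4 ^ k) * (\<integral>\<^sup>+x. ennreal ((d k x)\<^sup>2) \<partial>lborel)"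
      by (subst nn_integral_cmult[symmetric]) (auto simp: ennreal_mult)
    also have "\<dots> = ennreal (4 ^ k) * ennreal ((norm (u (Suc k) - u k))\<^sup>2)"
      unfolding d_def by (simp add: nn_integral_sq_diff sq_integrable_rep)
    also have "\<dots> \<le> ennreal (4 ^ k) * ennreal ((1/8) ^ k)"
      using fast by (intro mult_left_mono ennreal_leI) auto
    also have "\<dots> = ennreal ((1/2) ^ k)"
      by (subst ennreal_mult[symmetric]) (auto simp: power_mult_distrib[symmetric])
    finally show ?thesis .
  qed
  then have "(\<Sum>k. \<integral>\<^sup>+x. ennreal (4 ^ k * (d k x)\<^sup>2) \<partial>lborel) \<le> (\<Sum>k. ennreal ((1/2) ^ k))"
    by (intro suminf_le) auto
  also have "\<dots> = ennreal (\<Sum>k. (1/2) ^ k)"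
    by (intro suminf_ennreal2) (auto intro: summable_geometric)
  also have "\<dots> < \<infinity>" by simp
  finally have "(\<integral>\<^sup>+x. (\<Sum>k. ennreal (4 ^ k * (d k x)\<^sup>2)) \<partial>lborel) \<noteq> \<infinity>"
    by (subst nn_integral_suminf) auto
  then have "AE x in lborel. (\<Sum>k. ennreal (4 ^ k * (d k x)\<^sup>2)) \<noteq> \<infinity>"
    by (intro nn_integral_PInf_AE) auto
  then show ?thesis
  proof eventually_elim
    case (elim x)
    then have fin: "(\<Sum>k. ennreal (4 ^ k * (d k x)\<^sup>2)) < top" by (simp add: less_top)
    define C where "C = enn2real (\<Sum>k. ennreal (4 ^ k * (d k x)\<^sup>2))"
    have C: "(\<Sum>k. ennreal (4 ^ k * (d k x)\<^sup>2)) = ennreal C" "C \<ge> 0"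
      using ennreal_enn2real[OF fin] by (simp_all only: C_def enn2real_nonneg)
    have d_le: "\<bar>d k x\<bar> \<le> sqrt C * (1/2) ^ k" for k
    proof -
      have "ennreal (4 ^ k * (d k x)\<^sup>2) \<le> ennreal C"
        using sum_le_suminf[of "\<lambda>k. ennreal (4 ^ k * (d k x)\<^sup>2)" "{k}"] unfolding C(1) by simp
      moreover have "(2 ^ k * \<bar>d k x\<bar>)\<^sup>2 = 4 ^ k * (d k x)\<^sup>2"
      proof -
        have "(4::real) ^ k = (2 * 2) ^ k" by simp
        also have "\<dots> = (2 ^ k)\<^sup>2" by (simp only: power_mult_distrib power2_eq_square)
        finally show ?thesis by (simp add: power_mult_distrib)
      qed
      ultimately have "(2 ^ k * \<bar>d k x\<bar>)\<^sup>2 \<le> C"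
        using C(2) by simp
      then have "2 ^ k * \<bar>d k x\<bar> \<le> sqrt C" by (simp add: real_le_rsqrt)
      then show ?thesis by (simp add: field_simps power_divide)
    qed
    have "summable (\<lambda>k. d k x)"
      by (rule summable_comparison_test'[where g = "\<lambda>k. sqrt C * (1/2) ^ k"])
        (use d_le in \<open>auto intro!: summable_mult summable_geometric\<close>)
    then have "convergent (\<lambda>n. \<Sum>k<n. d k x)" by (simp add: summable_iff_convergent)
    moreover have "(\<Sum>k<n. d k x) = rep_l2 (u n) x - rep_l2 (u 0) x" for n
      by (induction n) (auto simp: d_def)
    ultimately have "convergent (\<lambda>n. (rep_l2 (u n) x - rep_l2 (u 0) x) + rep_l2 (u 0) x)"
      by (intro convergent_add) (auto simp: convergent_const)
    then show ?case by simp
  qed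
qed

text \<open>The Riesz-Fischer theorem. A fast subsequence converges almost everywhere to some \<open>g\<close>; Fatou's lemma turns the Cauchy
bounds along the subsequence into bounds for the distance to \<open>g\<close>, and these give both that \<open>g\<close> is square integrable and
that the whole sequence converges to it.\<close>

lemma Cauchy_l2_convergent:
  fixes X :: "nat \<Rightarrow> 'a::euclidean_space l2"
  assumes "Cauchy X"
  shows "convergent X"
proof -
  have "\<exists>r. strict_mono r \<and> (\<forall>k. (norm (X (r (Suc k)) - X (r k)))\<^sup>2 \<le> (1/8) ^ k)"
  proof -
    have "\<forall>k. \<exists>N. \<forall>m\<ge>N. \<forall>n\<ge>N. norm (X m - X n) < sqrt ((1/8) ^ k)"
      using assms unfolding Cauchy_iff by simp
    then obtain N where N: "\<And>k m n. m \<ge> N k \<Longrightarrow> n \<ge> N k \<Longrightarrow> norm (X m - X n) < sqrt ((1/8) ^ k)"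
      by metis
    define r where "r = rec_nat (N 0) (\<lambda>k rk. max (Suc rk) (N (Suc k)))"
    have r_simps: "r 0 = N 0" "r (Suc k) = max (Suc (r k)) (N (Suc k))" for k
      by (simp_all add: r_def)
    have "strict_mono r" unfolding strict_mono_Suc_iff r_simps(2) by (simp add: less_max_iff_disj)
    moreover have "r k \<ge> N k" for k by (cases k) (simp_all add: r_simps)
    then have "norm (X (r (Suc k)) - X (r k)) < sqrt ((1/8) ^ k)" for k
      by (intro N) (meson \<open>strict_mono r\<close> le_trans less_or_eq_imp_le strict_mono_Suc_iff, simp)
    then have "(norm (X (r (Suc k)) - X (r k)))\<^sup>2 \<le> (sqrt ((1/8) ^ k))\<^sup>2" for k
      by (intro power_mono) (auto simp: less_imp_le)
    ultimately show ?thesis by (auto simp: power_one_over)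
  qed
  then obtain r where r: "strict_mono r" "\<And>k. (norm (X (r (Suc k)) - X (r k)))\<^sup>2 \<le> (1/8) ^ k"
    by blast
  define g where "g x = lim (\<lambda>k. rep_l2 (X (r k)) x)" for x
  have g_meas [measurable]: "g \<in> borel_measurable borel" unfolding g_def by measurable
  have lim: "AE x in lborel. (\<lambda>k. rep_l2 (X (r k)) x) \<longlonglongrightarrow> g x"
    using fast_Cauchy_convergent_AE[of "\<lambda>k. X (r k)", OF r(2)]
    by eventually_elim (simp add: g_def convergent_LIMSEQ_iff)
  have fatou: "(\<integral>\<^sup>+x. ennreal ((rep_l2 (X n) x - g x)\<^sup>2) \<partial>lborel) \<le> ennreal (e\<^sup>2)"
    if "e > 0" and N: "\<And>m. m \<ge> N \<Longrightarrow> norm (X n - X m) < e" for n N e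
  proof -
    have "(\<integral>\<^sup>+x. ennreal ((rep_l2 (X n) x - g x)\<^sup>2) \<partial>lborel)
        = (\<integral>\<^sup>+x. liminf (\<lambda>k. ennreal ((rep_l2 (X n) x - rep_l2 (X (r k)) x)\<^sup>2)) \<partial>lborel)"
    proof (rule nn_integral_cong_AE, use lim in eventually_elim)
      case (elim x)
      then have "(\<lambda>k. ennreal ((rep_l2 (X n) x - rep_l2 (X (r k)) x)\<^sup>2))
          \<longlonglongrightarrow> ennreal ((rep_l2 (X n) x - g x)\<^sup>2)"
        by (intro tendsto_intros)
      then show ?case by (intro lim_imp_Liminf[symmetric]) auto
    qed
    also have "\<dots> \<le> liminf (\<lambda>k. \<integral>\<^sup>+x. ennreal ((rep_l2 (X n) x - rep_l2 (X (r k)) x)\<^sup>2) \<partial>lborel)"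
      by (intro nn_integral_liminf) measurable
    also have "\<dots> = liminf (\<lambda>k. ennreal ((norm (X n - X (r k)))\<^sup>2))"
      by (simp add: nn_integral_sq_diff sq_integrable_rep)
    also have "\<dots> \<le> ennreal (e\<^sup>2)"
    proof (rule Liminf_le)
      show "\<forall>\<^sub>F k in sequentially. ennreal ((norm (X n - X (r k)))\<^sup>2) \<le> ennreal (e\<^sup>2)"
        using eventually_ge_at_top[of N]
      proof eventually_elim
        case (elim k)
        then have "norm (X n - X (r k)) < e"
          using N seq_suble[OF r(1), of k] by simp
        then show ?case by (intro ennreal_leI power_mono) auto
      qed
    qed simp
    finally show ?thesis .
  qed
  have tail: "\<exists>N. \<forall>n\<ge>N. \<forall>m\<ge>N. norm (X n - X m) < e" if "e > 0" for e
    using assms that unfolding Cauchy_iff by simp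
  obtain N where N: "\<And>n m. n \<ge> N \<Longrightarrow> m \<ge> N \<Longrightarrow> norm (X n - X m) < 1" using tail[of 1] by auto
  have "integrable lborel (\<lambda>x. (rep_l2 (X N) x - g x)\<^sup>2)"
  proof (rule integrableI_bounded)
    show "(\<integral>\<^sup>+x. ennreal (norm ((rep_l2 (X N) x - g x)\<^sup>2)) \<partial>lborel) < \<infinity>"
      using fatou[of 1 N N] N by (auto simp: order_le_less_trans)
  qed measurable
  then have "sq_integrable (\<lambda>x. rep_l2 (X N) x - g x)" by (simp add: sq_integrable_def)
  from sq_integrable_diff[OF sq_integrable_rep[of "X N"] this] have g: "sq_integrable g" by simp
  have "X \<longlonglongrightarrow> abs_l2 g"
  proof (rule LIMSEQ_I)
    fix e :: real
    assume "e > 0"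
    then obtain N where N: "\<And>n m. n \<ge> N \<Longrightarrow> m \<ge> N \<Longrightarrow> norm (X n - X m) < e / 2"
      using tail[of "e / 2"] by auto
    have "norm (X n - abs_l2 g) < e" if "n \<ge> N" for n
    proof -
      have "ennreal ((norm (X n - abs_l2 g))\<^sup>2) \<le> ennreal ((e / 2)\<^sup>2)"
        using fatou[of "e / 2" N n] N[OF that] \<open>e > 0\<close>
          nn_integral_sq_diff[OF sq_integrable_rep[of "X n"] g] by simp
      then have "norm (X n - abs_l2 g) \<le> e / 2"
        using \<open>e > 0\<close> by (simp add: power2_le_iff_abs_le)
      then show ?thesis using \<open>e > 0\<close> by simp
    qed
    then show "\<exists>N. \<forall>n\<ge>N. norm (X n - abs_l2 g) < e" by blast
  qed
  then show ?thesis by (auto simp: convergent_def)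
qed

section \<open>L2 on a subset\<close>

text \<open>Vanishing outside \<open>\<Omega>\<close> is orthogonality to all functions cut off to the complement of \<open>\<Omega>\<close>. In this form the linearity
and the closedness of the space are immediate.\<close>

lemma L2_iff_orthogonal:
  fixes \<Omega> :: "'a::euclidean_space set"
  assumes [measurable]: "\<Omega> \<in> sets borel"
  shows "u \<in> L2 \<Omega> \<longleftrightarrow> (\<forall>v. inner u (abs_l2 (\<lambda>x. indicator (- \<Omega>) x * rep_l2 v x)) = 0)"
proof -
  have cut: "sq_integrable (\<lambda>x. indicator (- \<Omega>) x * rep_l2 v x)" for v
  proof -
    have "integrable lborel (\<lambda>x. (rep_l2 v x)\<^sup>2)"
      using sq_integrable_rep[of v] by (simp add: sq_integrable_def)
    then have "integrable lborel (\<lambda>x. (indicator (- \<Omega>) x * rep_l2 v x)\<^sup>2)"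
      by (rule Bochner_Integration.integrable_bound) (auto simp: indicator_def)
    then show ?thesis by (auto simp: sq_integrable_def)
  qed
  show ?thesis
  proof
    assume u: "u \<in> L2 \<Omega>"
    show "\<forall>v. inner u (abs_l2 (\<lambda>x. indicator (- \<Omega>) x * rep_l2 v x)) = 0"
    proof
      fix v
      have "AE x in lborel. rep_l2 u x * (indicator (- \<Omega>) x * rep_l2 v x) = 0"
        using u unfolding L2_def by (auto elim!: eventually_mono simp: indicator_def)
      then show "inner u (abs_l2 (\<lambda>x. indicator (- \<Omega>) x * rep_l2 v x)) = 0"
        by (simp add: inner_rep_abs[OF cut] integral_eq_zero_AE)
    qed
  next
    let ?f = "\<lambda>x. rep_l2 u x * (indicator (- \<Omega>) x * rep_l2 u x)"
    assume "\<forall>v. inner u (abs_l2 (\<lambda>x. indicator (- \<Omega>) x * rep_l2 v x)) = 0"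
    then have "integral\<^sup>L lborel ?f = 0" by (simp add: inner_rep_abs[OF cut])
    then have "AE x in lborel. ?f x = 0"
      using sq_integrable_mult[OF sq_integrable_rep cut]
      by (subst (asm) integral_nonneg_eq_0_iff_AE) (auto simp: indicator_def)
    then show "u \<in> L2 \<Omega>"
      unfolding L2_def by (auto elim!: eventually_mono simp: indicator_def)
  qed
qed

lemma subspace_L2: "\<Omega> \<in> sets borel \<Longrightarrow> subspace (L2 \<Omega>)"
  by (auto simp: subspace_def L2_iff_orthogonal inner_add_left)

lemma L2_limit:
  assumes "\<Omega> \<in> sets borel" "\<And>n. X n \<in> L2 \<Omega>" "X \<longlonglongrightarrow> u"
  shows "u \<in> L2 \<Omega>"
proof -
  have "inner u w = 0" if "\<And>n. inner (X n) w = 0" for w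
    using tendsto_inner[OF assms(3) tendsto_const[of w]] that by (simp add: LIMSEQ_const_iff)
  then show ?thesis using assms(1,2) by (simp add: L2_iff_orthogonal)
qed


section \<open>Smooth functions\<close>

lemma partial_deriv_eq: "(f has_derivative D) (at x) \<Longrightarrow> partial_deriv b f x = D b"
  by (simp add: partial_deriv_def frechet_derivative_at[symmetric])

lemma Ck_continuous: "Ck k f \<Longrightarrow> continuous_on UNIV f"
  by (cases k) (auto simp: continuous_on_eq_continuous_at differentiable_imp_continuous_within)

lemma Ck_decrease: "Ck (Suc k) f \<Longrightarrow> Ck k f"
proof (induction k arbitrary: f)
  case 0
  then show ?case using Ck_continuous[OF 0] by simp
qed auto

lemma Ck_const: "Ck k (\<lambda>_. c)"
proof (induction k arbitrary: c)
  case (Suc k)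
  have "partial_deriv b (\<lambda>_. c) = (\<lambda>_::'a. 0)" for b
    by (rule ext) (simp add: partial_deriv_eq[OF has_derivative_const])
  then show ?case using Suc by simp
qed simp

lemma Ck_coord: "Ck k (\<lambda>x. x \<bullet> i)"
proof (cases k)
  case (Suc m)
  have D: "((\<lambda>x. x \<bullet> i) has_derivative (\<lambda>h. h \<bullet> i)) (at x)" for x :: 'a
    by (auto intro!: derivative_eq_intros)
  have "partial_deriv b (\<lambda>x. x \<bullet> i) = (\<lambda>_. b \<bullet> i)" for b
    by (rule ext) (rule partial_deriv_eq[OF D])
  then show ?thesis unfolding Suc using D by (auto simp: Ck_const differentiable_def)
qed (auto intro: continuous_intros)

lemma partial_deriv_add:
  assumes "f differentiable at x" "g differentiable at x"
  shows "partial_deriv b (\<lambda>x. f x + g x) x = partial_deriv b f x + partial_deriv b g x"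
  using assms[unfolded frechet_derivative_works]
  unfolding partial_deriv_def[of b f] partial_deriv_def[of b g]
  by (rule partial_deriv_eq[OF has_derivative_add])

lemma partial_deriv_mult:
  assumes "f differentiable at x" "g differentiable at x"
  shows "partial_deriv b (\<lambda>x. f x * g x) x = f x * partial_deriv b g x + partial_deriv b f x * g x"
  using assms[unfolded frechet_derivative_works]
  unfolding partial_deriv_def[of b f] partial_deriv_def[of b g]
  by (rule partial_deriv_eq[OF has_derivative_mult])

lemma Ck_add: "Ck k f \<Longrightarrow> Ck k g \<Longrightarrow> Ck k (\<lambda>x. f x + g x)"
proof (induction k arbitrary: f g)
  case (Suc k)
  then have "partial_deriv b (\<lambda>x. f x + g x) = (\<lambda>x. partial_deriv b f x + partial_deriv b g x)" for b
    by (auto simp: partial_deriv_add)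
  then show ?case using Suc by (auto intro: differentiable_add)
qed (auto intro: continuous_intros)

lemma Ck_mult: "Ck k f \<Longrightarrow> Ck k g \<Longrightarrow> Ck k (\<lambda>x. f x * g x)"
proof (induction k arbitrary: f g)
  case (Suc k)
  then have "partial_deriv b (\<lambda>x. f x * g x)
      = (\<lambda>x. f x * partial_deriv b g x + partial_deriv b f x * g x)" for b
    by (auto simp: partial_deriv_mult)
  then show ?case using Suc Ck_decrease[OF Suc.prems(1)] Ck_decrease[OF Suc.prems(2)]
    by (auto intro!: differentiable_mult Ck_add)
qed (auto intro: continuous_intros)

lemma Ck_prod: "finite I \<Longrightarrow> (\<And>i. i \<in> I \<Longrightarrow> Ck k (f i)) \<Longrightarrow> Ck k (\<lambda>x. \<Prod>i\<in>I. f i x)"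
  by (induction I rule: finite_induct) (auto intro: Ck_const Ck_mult)

text \<open>The family is closed under differentiation, up to linear combinations, and contains for \<open>n = 0\<close> the classical smooth
function that vanishes to infinite order at \<open>0\<close>. This makes its smoothness a plain induction.\<close>

definition flat :: "nat \<Rightarrow> real \<Rightarrow> real" where
  "flat n t = (if t > 0 then (1/t) ^ n * exp (- (1/t)) else 0)"

lemma power_le_fact_exp:
  assumes "y \<ge> (0::real)"
  shows "y ^ n \<le> fact n * exp y"
proof -
  have "(\<lambda>k. y ^ k /\<^sub>R fact k) sums exp y" by (rule exp_converges)
  then have "sum (\<lambda>k. y ^ k /\<^sub>R fact k) {n} \<le> exp y"
    using assms by (intro sum_le_suminf[THEN order_trans]) (auto simp: sums_iff)
  then show ?thesis by (simp add: field_simps)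
qed

text \<open>A bound linear in \<open>t\<close> is all that is needed at \<open>0\<close>: the difference quotient of \<open>flat n\<close> at \<open>0\<close> is \<open>flat (Suc n)\<close>,
which tends to \<open>0\<close> by this bound.\<close>

lemma flat_le: "\<bar>flat n t\<bar> \<le> fact (Suc n) * \<bar>t\<bar>"
proof (cases "t > 0")
  case True
  have "(1/t) ^ Suc n \<le> fact (Suc n) * exp (1/t)"
    using True by (intro power_le_fact_exp) simp
  then have "(1/t) ^ Suc n * exp (- (1/t)) * t \<le> fact (Suc n) * t"
    using True by (intro mult_right_mono) (auto simp: exp_minus field_simps)
  then show ?thesis using True by (simp add: flat_def abs_mult)
next
  case False
  have "0 \<le> fact (Suc n) * \<bar>t\<bar>" by (intro mult_nonneg_nonneg) auto
  with False show ?thesis by (simp only: flat_def if_False abs_zero)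
qed

lemma DERIV_flat: "(flat n has_real_derivative (flat (n + 2) t - real n * flat (Suc n) t)) (at t)"
proof -
  consider "t > 0" | "t < 0" | "t = 0" by linarith
  then show ?thesis
  proof cases
    case 1
    have inv: "((\<lambda>t. 1/t) has_real_derivative - (1/t)\<^sup>2) (at t)"
      using 1 by (auto intro!: derivative_eq_intros simp: power2_eq_square)
    have "((\<lambda>t. (1/t) ^ n * exp (- (1/t))) has_real_derivative
        (real n * (- (1/t)\<^sup>2 * (1/t) ^ (n - Suc 0))) * exp (- (1/t))
        + exp (- (1/t)) * - (- (1/t)\<^sup>2) * (1/t) ^ n) (at t)"
      by (intro DERIV_mult DERIV_power DERIV_fun_exp DERIV_minus inv)
    also have "(real n * (- (1/t)\<^sup>2 * (1/t) ^ (n - Suc 0))) * exp (- (1/t))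
        + exp (- (1/t)) * - (- (1/t)\<^sup>2) * (1/t) ^ n = flat (n + 2) t - real n * flat (Suc n) t"
    proof -
      define y where "y = 1/t"
      show ?thesis using 1 unfolding flat_def y_def[symmetric]
        by (cases n) (simp_all add: power2_eq_square algebra_simps)
    qed
    finally have "((\<lambda>t. (1/t) ^ n * exp (- (1/t))) has_real_derivative
        (flat (n + 2) t - real n * flat (Suc n) t)) (at t)" .
    then show ?thesis
      by (rule has_field_derivative_transform_within_open[where S = "{0<..}"])
        (use 1 in \<open>auto simp: flat_def\<close>)
  next
    case 2
    have "((\<lambda>t. 0) has_real_derivative (flat (n + 2) t - real n * flat (Suc n) t)) (at t)"
      using 2 by (simp add: flat_def)
    then show ?thesis
      by (rule has_field_derivative_transform_within_open[where S = "{..<0}"])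
        (use 2 in \<open>auto simp: flat_def\<close>)
  next
    case 3
    have "((\<lambda>h. fact (Suc (Suc n)) * \<bar>h\<bar>) \<longlongrightarrow> fact (Suc (Suc n)) * \<bar>0\<bar>) (at (0::real))"
      by (intro tendsto_intros)
    then have "(flat (Suc n) \<longlongrightarrow> 0) (at 0)"
      by (intro Lim_null_comparison[of "flat (Suc n)" "\<lambda>h. fact (Suc (Suc n)) * \<bar>h\<bar>"])
        (auto simp: flat_le simp del: fact_Suc)
    moreover have "flat (Suc n) = (\<lambda>h. (flat n (0 + h) - flat n 0) / h)"
      by (rule ext) (simp add: flat_def)
    ultimately have "(\<lambda>h. (flat n (0 + h) - flat n 0) / h) \<midarrow>0\<rightarrow> 0"
      by (simp only:)
    then show ?thesis unfolding 3 DERIV_def by (simp add: flat_def)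
  qed
qed

lemma Ck_flat: "Ck k (\<lambda>x. flat n (c * (x \<bullet> i) + d))"
proof (induction k arbitrary: n)
  have D: "((\<lambda>x. flat n (c * (x \<bullet> i) + d)) has_derivative
      (\<lambda>h. (flat (n + 2) (c * (x \<bullet> i) + d) - real n * flat (Suc n) (c * (x \<bullet> i) + d)) * (c * (h \<bullet> i)))) (at x)"
    for n and x :: 'a
  proof -
    have "((\<lambda>x. c * (x \<bullet> i) + d) has_derivative (\<lambda>h. c * (h \<bullet> i))) (at x)"
      by (auto intro!: derivative_eq_intros)
    from has_derivative_compose[OF this DERIV_flat[unfolded has_field_derivative_def]]
    show ?thesis .
  qed
  {
    case 0
    show ?case
      using has_derivative_continuous[OF D] by (simp add: continuous_on_eq_continuous_at)
  next
    case (Suc k)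
    have "partial_deriv b (\<lambda>x. flat n (c * (x \<bullet> i) + d)) =
       (\<lambda>x. (flat (n + 2) (c * (x \<bullet> i) + d) + (- real n) * flat (Suc n) (c * (x \<bullet> i) + d)) * (c * (b \<bullet> i)))" for b
      by (rule ext) (simp add: partial_deriv_eq[OF D])
    moreover have "(\<lambda>x. flat n (c * (x \<bullet> i) + d)) differentiable at x" for x :: 'a
      using D unfolding differentiable_def by blast
    ultimately show ?case
      unfolding Ck.simps by (simp only:) (intro allI ballI conjI TrueI Ck_mult Ck_add Ck_const Suc)
  }
qed


section \<open>Test functions\<close>

lemma partial_deriv_eq_0:
  assumes "closed K" "\<And>x. x \<notin> K \<Longrightarrow> f x = 0" "x \<notin> K"
  shows "partial_deriv b f x = 0"
proof -
  have "(f has_derivative (\<lambda>_. 0)) (at x)"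
    by (rule has_derivative_transform_within_open[of "\<lambda>_. 0" _ _ _ "- K"])
       (use assms in auto)
  then show ?thesis by (simp add: partial_deriv_eq)
qed

lemma test_function_smooth: "\<phi> \<in> test_functions \<Omega> \<Longrightarrow> Ck k \<phi>"
  by (simp add: test_functions_def)

lemma test_functionI:
  assumes "\<And>k. Ck k \<phi>" "compact K" "K \<subseteq> \<Omega>" "\<And>x. x \<notin> K \<Longrightarrow> \<phi> x = 0"
  shows "\<phi> \<in> test_functions \<Omega>"
proof -
  have "closure {x. \<phi> x \<noteq> 0} \<subseteq> K"
    using assms by (intro closure_minimal) (auto simp: compact_imp_closed)
  moreover from this have "compact (closure {x. \<phi> x \<noteq> 0})"
    using compact_Int_closed[OF assms(2) closed_closure[of "{x. \<phi> x \<noteq> 0}"]]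
    by (simp add: Int_absorb1)
  ultimately show ?thesis using assms by (auto simp: test_functions_def)
qed

lemma test_function_support:
  assumes "\<phi> \<in> test_functions \<Omega>"
  shows "\<exists>K. compact K \<and> K \<subseteq> \<Omega> \<and> (\<forall>x. x \<notin> K \<longrightarrow> \<phi> x = 0)"
  using assms closure_subset[of "{x. \<phi> x \<noteq> 0}"]
  by (intro exI[of _ "closure {x. \<phi> x \<noteq> 0}"]) (auto simp: test_functions_def)

lemma test_function_mult:
  assumes "\<phi> \<in> test_functions \<Omega>" "\<And>k. Ck k g"
  shows "(\<lambda>x. g x * \<phi> x) \<in> test_functions \<Omega>"
proof -
  obtain K where "compact K" "K \<subseteq> \<Omega>" "\<forall>x. x \<notin> K \<longrightarrow> \<phi> x = 0"
    using test_function_support[OF assms(1)] by blast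
  then show ?thesis using assms test_function_smooth[OF assms(1)]
    by (intro test_functionI[where K = K] Ck_mult) auto
qed

lemma test_function_add:
  assumes \<phi>: "\<phi> \<in> test_functions \<Omega>" and \<psi>: "\<psi> \<in> test_functions \<Omega>"
  shows "(\<lambda>x. \<phi> x + \<psi> x) \<in> test_functions \<Omega>"
proof -
  obtain K where "compact K" "K \<subseteq> \<Omega>" "\<forall>x. x \<notin> K \<longrightarrow> \<phi> x = 0"
    using test_function_support[OF \<phi>] by blast
  moreover obtain K' where "compact K'" "K' \<subseteq> \<Omega>" "\<forall>x. x \<notin> K' \<longrightarrow> \<psi> x = 0"
    using test_function_support[OF \<psi>] by blast
  ultimately show ?thesis
    by (intro test_functionI[where K = "K \<union> K'"] Ck_add test_function_smooth[OF \<phi>] test_function_smooth[OF \<psi>]) auto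
qed

lemma partial_deriv_test_function:
  assumes "\<phi> \<in> test_functions \<Omega>" "b \<in> Basis"
  shows "partial_deriv b \<phi> \<in> test_functions \<Omega>"
proof -
  obtain K where K: "compact K" "K \<subseteq> \<Omega>" "\<forall>x. x \<notin> K \<longrightarrow> \<phi> x = 0"
    using test_function_support[OF assms(1)] by blast
  show ?thesis
  proof (rule test_functionI[OF _ K(1,2)])
    show "Ck k (partial_deriv b \<phi>)" for k
      using test_function_smooth[OF assms(1), of "Suc k"] assms(2) by simp
    show "partial_deriv b \<phi> x = 0" if "x \<notin> K" for x
      using partial_deriv_eq_0[OF compact_imp_closed[OF K(1)] K(3)[rule_format] that] .
  qed
qed

lemma integrable_compact_support:
  fixes f :: "'a::euclidean_space \<Rightarrow> real"
  assumes "continuous_on UNIV f" "compact K" "\<And>x. x \<notin> K \<Longrightarrow> f x = 0"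
  shows "integrable lborel f"
proof -
  have "integrable lborel (\<lambda>x. indicator K x *\<^sub>R f x)"
    using assms by (intro borel_integrable_compact) (auto intro: continuous_on_subset)
  also have "(\<lambda>x. indicator K x *\<^sub>R f x) = f"
    using assms(3) by (auto simp: indicator_def fun_eq_iff)
  finally show ?thesis .
qed

lemma test_function_sq_integrable:
  assumes "\<phi> \<in> test_functions \<Omega>"
  shows "sq_integrable \<phi>"
proof -
  obtain K where "compact K" "K \<subseteq> \<Omega>" "\<forall>x. x \<notin> K \<longrightarrow> \<phi> x = 0"
    using test_function_support[OF assms(1)] by blast
  moreover have cont: "continuous_on UNIV \<phi>"
    using Ck_continuous[OF test_function_smooth[OF assms, of 0]] .
  ultimately have "integrable lborel (\<lambda>x. (\<phi> x)\<^sup>2)"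
    by (intro integrable_compact_support[of _ K]) (auto intro: continuous_intros)
  then show ?thesis using cont by (simp add: sq_integrable_def borel_measurable_continuous_onI)
qed

lemma test_function_in_L2:
  assumes "\<phi> \<in> test_functions \<Omega>"
  shows "abs_l2 \<phi> \<in> L2 \<Omega>"
proof -
  obtain K where "K \<subseteq> \<Omega>" "\<forall>x. x \<notin> K \<longrightarrow> \<phi> x = 0"
    using test_function_support[OF assms(1)] by blast
  then show ?thesis
    using rep_abs[OF test_function_sq_integrable[OF assms]] unfolding L2_def
    by (auto elim!: eventually_mono)
qed

section \<open>The fundamental lemma of the calculus of variations\<close>

text \<open>A smooth approximation from below of the indicator of a box. The shift by \<open>-1\<close> keeps the support at distance
\<open>1 / m\<close> from the faces, so that it is a compact subset of the open box.\<close>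

definition box_bump :: "nat \<Rightarrow> 'a::euclidean_space \<Rightarrow> 'a \<Rightarrow> 'a \<Rightarrow> real" where
  "box_bump m a b x = (\<Prod>i\<in>Basis. flat 0 (real m * (x \<bullet> i - a \<bullet> i) - 1) * flat 0 (real m * (b \<bullet> i - x \<bullet> i) - 1))"

lemma flat0_bounds: "0 \<le> flat 0 t" "flat 0 t \<le> 1"
  by (auto simp: flat_def)

lemma Ck_box_bump: "Ck k (box_bump m a b)"
proof -
  have eq: "real m * (x \<bullet> i - a \<bullet> i) - 1 = real m * (x \<bullet> i) + (- real m * (a \<bullet> i) - 1)"
    "real m * (b \<bullet> i - x \<bullet> i) - 1 = (- real m) * (x \<bullet> i) + (real m * (b \<bullet> i) - 1)" for x i :: 'a
    by (auto simp: algebra_simps)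
  show ?thesis unfolding box_bump_def eq by (intro Ck_prod Ck_mult Ck_flat) simp
qed

lemma box_bump_test_function:
  assumes "box a b \<subseteq> \<Omega>"
  shows "box_bump (Suc m) a b \<in> test_functions \<Omega>"
proof (rule test_functionI[where K = "cbox (a + (1 / real (Suc m)) *\<^sub>R One) (b - (1 / real (Suc m)) *\<^sub>R One)"])
  let ?K = "cbox (a + (1 / real (Suc m)) *\<^sub>R One) (b - (1 / real (Suc m)) *\<^sub>R One)"
  have pos: "0 < 1 / real (Suc m)" by simp
  have "?K \<subseteq> box a b"
  proof
    fix x assume x: "x \<in> ?K"
    show "x \<in> box a b" unfolding mem_box
    proof
      fix i :: 'a assume i: "i \<in> Basis"
      then have "a \<bullet> i + 1 / real (Suc m) \<le> x \<bullet> i" "x \<bullet> i \<le> b \<bullet> i - 1 / real (Suc m)"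
        using x by (auto simp: mem_box inner_simps simp del: of_nat_Suc)
      then show "a \<bullet> i < x \<bullet> i \<and> x \<bullet> i < b \<bullet> i" using pos by linarith
    qed
  qed
  then show "?K \<subseteq> \<Omega>" using assms by simp
  show "box_bump (Suc m) a b x = 0" if "x \<notin> ?K" for x
  proof -
    have "\<exists>i\<in>Basis. x \<bullet> i < a \<bullet> i + 1 / real (Suc m) \<or> b \<bullet> i - 1 / real (Suc m) < x \<bullet> i"
      using that by (fastforce simp: mem_box inner_simps not_le simp del: of_nat_Suc)
    then obtain i where i: "i \<in> Basis"
      and "x \<bullet> i < a \<bullet> i + 1 / real (Suc m) \<or> b \<bullet> i - 1 / real (Suc m) < x \<bullet> i"
      by blast
    then have "real (Suc m) * (x \<bullet> i - a \<bullet> i) - 1 \<le> 0 \<or> real (Suc m) * (b \<bullet> i - x \<bullet> i) - 1 \<le> 0"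
      by (auto simp: field_simps simp del: of_nat_Suc)
    then have "flat 0 (real (Suc m) * (x \<bullet> i - a \<bullet> i) - 1) * flat 0 (real (Suc m) * (b \<bullet> i - x \<bullet> i) - 1) = 0"
      by (auto simp: flat_def simp del: of_nat_Suc)
    then show ?thesis using i unfolding box_bump_def by (intro prod_zero) auto
  qed
qed (auto intro: Ck_box_bump)

lemma flat0_LIMSEQ: "(\<lambda>m. flat 0 (real (Suc m) * s - 1)) \<longlonglongrightarrow> (if s > 0 then 1 else 0)"
proof (cases "s > 0")
  case True
  have "filterlim (\<lambda>m. - 1 + s * real (Suc m)) at_top sequentially"
    using True by (intro filterlim_tendsto_add_at_top[OF tendsto_const]
        filterlim_tendsto_pos_mult_at_top[OF tendsto_const]
        filterlim_compose[OF filterlim_real_sequentially filterlim_Suc]) auto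
  then have lim: "filterlim (\<lambda>m. real (Suc m) * s - 1) at_top sequentially"
    by (simp add: mult.commute add.commute)
  have "((\<lambda>t. exp (- inverse t)) \<longlongrightarrow> exp (- 0)) (at_top :: real filter)"
    by (intro tendsto_intros tendsto_inverse_0_at_top filterlim_ident)
  then have "((\<lambda>t. exp (- (1/t))) \<longlongrightarrow> 1) (at_top :: real filter)"
    by (simp add: inverse_eq_divide)
  moreover have "\<forall>\<^sub>F t in at_top. exp (- (1/t)) = flat 0 t"
    using eventually_gt_at_top[of 0] by eventually_elim (simp add: flat_def)
  ultimately have "(flat 0 \<longlongrightarrow> 1) at_top" by (rule Lim_transform_eventually)
  from filterlim_compose[OF this lim] show ?thesis using True by simp
next
  case False
  then have "real (Suc m) * s \<le> 0" for m by (intro mult_nonneg_nonpos) auto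
  then have "flat 0 (real (Suc m) * s - 1) = 0" for m
    unfolding flat_def by (smt (verit))
  then show ?thesis using False by simp
qed

lemma box_bump_LIMSEQ: "(\<lambda>m. box_bump (Suc m) a b x) \<longlonglongrightarrow> indicator (box a b) x"
proof -
  have "(\<lambda>m. box_bump (Suc m) a b x) \<longlonglongrightarrow>
      (\<Prod>i\<in>Basis. (if x \<bullet> i - a \<bullet> i > 0 then 1 else 0) * (if b \<bullet> i - x \<bullet> i > 0 then 1 else 0))"
    unfolding box_bump_def by (intro tendsto_prod tendsto_mult flat0_LIMSEQ)
  also have "(\<Prod>i\<in>Basis. (if x \<bullet> i - a \<bullet> i > 0 then 1 else 0) * (if b \<bullet> i - x \<bullet> i > 0 then 1 else 0))
      = (indicator (box a b) x :: real)"
  proof (cases "x \<in> box a b")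
    case True
    then show ?thesis by (auto simp: mem_box intro!: prod.neutral)
  next
    case False
    then show ?thesis by (auto simp: mem_box intro!: prod_zero)
  qed
  finally show ?thesis .
qed

lemma box_bump_le: "\<bar>box_bump (Suc m) a b x\<bar> \<le> indicator (box a b) x"
proof (cases "x \<in> box a b")
  case True
  have "\<bar>box_bump (Suc m) a b x\<bar> \<le> 1"
    unfolding box_bump_def abs_prod
    by (intro prod_le_1) (auto simp: abs_mult flat0_bounds intro!: mult_le_one)
  then show ?thesis using True by simp
next
  case False
  then have "box_bump (Suc m) a b x = 0"
    using test_function_support[OF box_bump_test_function[OF order_refl, where a = a and b = b and m = m]] by blast
  then show ?thesis by simp
qed

lemma sq_integrable_indicator_box: "sq_integrable (indicator (box a b))"
  unfolding sq_integrable_def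
proof
  have "(\<lambda>x. (indicator (box a b) x)\<^sup>2) = (indicator (box a b) :: _ \<Rightarrow> real)"
    by (auto simp: indicator_def)
  then show "integrable lborel (\<lambda>x. (indicator (box a b) x :: real)\<^sup>2)"
    by (simp add: emeasure_lborel_box_eq)
qed simp

lemma box_integral_eq_0:
  fixes u :: "'a::euclidean_space l2"
  assumes "box a b \<subseteq> \<Omega>" "\<And>\<phi>. \<phi> \<in> test_functions \<Omega> \<Longrightarrow> inner u (abs_l2 \<phi>) = 0"
  shows "(\<integral>x. rep_l2 u x * indicator (box a b) x \<partial>lborel) = 0"
proof -
  have "(\<lambda>m. \<integral>x. rep_l2 u x * box_bump (Suc m) a b x \<partial>lborel)
      \<longlonglongrightarrow> (\<integral>x. rep_l2 u x * indicator (box a b) x \<partial>lborel)"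
  proof (rule integral_dominated_convergence[where w = "\<lambda>x. \<bar>rep_l2 u x * indicator (box a b) x\<bar>"])
    show "integrable lborel (\<lambda>x. \<bar>rep_l2 u x * indicator (box a b) x\<bar>)"
      by (intro integrable_abs sq_integrable_mult sq_integrable_rep sq_integrable_indicator_box)
    show "(\<lambda>x. rep_l2 u x * box_bump (Suc m) a b x) \<in> borel_measurable lborel" for m
      using borel_measurable_continuous_onI[OF Ck_continuous[OF Ck_box_bump[of 0 "Suc m" a b]]] by simp
    show "AE x in lborel. norm (rep_l2 u x * box_bump (Suc m) a b x) \<le> \<bar>rep_l2 u x * indicator (box a b) x\<bar>" for m
      by (simp add: abs_mult mult_left_mono box_bump_le)
  qed (auto intro!: tendsto_mult box_bump_LIMSEQ)
  moreover have "(\<integral>x. rep_l2 u x * box_bump (Suc m) a b x \<partial>lborel) = 0" for m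
    using assms box_bump_test_function[OF assms(1), of m]
    by (simp add: inner_rep_abs[OF test_function_sq_integrable, symmetric])
  ultimately show ?thesis by (simp add: LIMSEQ_const_iff)
qed

text \<open>Orthogonality to the bumps passes to the limit, so that the integral of \<open>u\<close> over every open box in \<open>\<Omega>\<close> is zero. The boxes
inside a fixed box form a generator stable under intersections, hence \<open>u\<close> vanishes almost everywhere on that box, and
countably many boxes cover \<open>\<Omega>\<close>. This gives the uniqueness of weak derivatives, without which \<open>weak_partial\<close>
would not be determined.\<close>

theorem fundamental_lemma:
  fixes u :: "'a::euclidean_space l2"
  assumes "open \<Omega>" "u \<in> L2 \<Omega>" and orth: "\<And>\<phi>. \<phi> \<in> test_functions \<Omega> \<Longrightarrow> inner u (abs_l2 \<phi>) = 0"
  shows "u = 0"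
proof -
  have on_box: "AE x in lborel. rep_l2 u x * indicator (box a b) x = 0" if ab: "box a b \<subseteq> \<Omega>" for a b
  proof (rule density_unique_real)
    let ?f = "\<lambda>x. rep_l2 u x * indicator (box a b) x"
    show f: "integrable lborel ?f"
      by (intro sq_integrable_mult sq_integrable_rep sq_integrable_indicator_box)
    show "integrable lborel (\<lambda>_. 0 :: real)" by simp
    have f_on: "set_integrable lborel A ?f" if "A \<in> sets borel" for A
      unfolding set_integrable_def using that f by (intro integrable_mult_indicator) simp_all
    fix A :: "'a set" assume "A \<in> sets lborel"
    then have A_sigma: "A \<in> sigma_sets UNIV (range (\<lambda>(a, b). box a b))" by (simp add: borel_eq_box)
    have "Int_stable (range (\<lambda>(a, b). box a b :: 'a set))"
      by (auto simp: Int_stable_def box_Int_box)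
    moreover have "range (\<lambda>(a, b). box a b :: 'a set) \<subseteq> Pow UNIV" by auto
    moreover note A_sigma
    ultimately have "(LINT x:A|lborel. ?f x) = 0"
    proof (induction rule: sigma_sets_induct_disjoint)
      case (basic A)
      then obtain c d where A: "A = box c d" by auto
      have "\<exists>c' d'. box c d \<inter> box a b = box c' d'" by (intro exI) (rule box_Int_box)
      then obtain c' d' where I: "box c d \<inter> box a b = box c' d'" by blast
      have "(LINT x:A|lborel. ?f x) = (\<integral>x. rep_l2 u x * indicator (box c' d') x \<partial>lborel)"
        unfolding set_lebesgue_integral_def A I[symmetric]
        by (intro Bochner_Integration.integral_cong) (auto simp: indicator_def)
      also have "\<dots> = 0" using I ab orth by (intro box_integral_eq_0[of _ _ \<Omega>]) auto
      finally show ?case .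
    next
      case empty
      then show ?case by (simp add: set_lebesgue_integral_def)
    next
      case (compl A)
      then have [measurable]: "A \<in> sets borel" by (simp add: borel_eq_box)
      have "set_integrable lborel A ?f" "set_integrable lborel (UNIV - A) ?f"
        by (simp_all add: f_on)
      then have "(LINT x:A \<union> (UNIV - A)|lborel. ?f x) = (LINT x:A|lborel. ?f x) + (LINT x:UNIV - A|lborel. ?f x)"
        by (intro set_integral_Un) auto
      moreover have "(LINT x:A \<union> (UNIV - A)|lborel. ?f x) = 0"
        using box_integral_eq_0[OF ab orth] by (simp add: set_lebesgue_integral_def)
      ultimately show ?case using compl by simp
    next
      case (union A)
      have A: "A i \<in> sets borel" for i using union(2) by (auto simp: borel_eq_box)
      then have "set_integrable lborel (\<Union>i. A i) ?f"
        by (intro f_on) auto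
      then have "(LINT x:(\<Union>i. A i)|lborel. ?f x) = (\<Sum>i. LINT x:(A i)|lborel. ?f x)"
        using A union(1) by (intro lebesgue_integral_countable_add) (auto simp: disjoint_family_on_def)
      then show ?case using union(3) by simp
    qed
    then show "(LINT x:A|lborel. ?f x) = (LINT x:A|lborel. 0)"
      by (simp add: set_lebesgue_integral_def)
  qed
  obtain \<D> where D: "countable \<D>" "\<D> \<subseteq> Pow \<Omega>" "\<And>X. X \<in> \<D> \<Longrightarrow> \<exists>a b. X = box a b" "\<Union>\<D> = \<Omega>"
    using open_countable_Union_open_box[OF \<open>open \<Omega>\<close>] by blast
  have "AE x in lborel. \<forall>X\<in>\<D>. rep_l2 u x * indicator X x = 0"
    using D(2,3) on_box by (subst AE_ball_countable[OF D(1)]) blast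
  moreover have "AE x in lborel. x \<notin> \<Omega> \<longrightarrow> rep_l2 u x = 0" using assms(2) by (simp add: L2_def)
  ultimately have "AE x in lborel. rep_l2 u x = 0"
    by eventually_elim (use D(4) in \<open>auto simp: indicator_def split: if_splits\<close>)
  then have "abs_l2 (rep_l2 u) = abs_l2 (\<lambda>_. 0)"
    by (intro abs_l2_eqI) (auto simp: sq_integrable_rep sq_integrable_zero)
  then show ?thesis by (simp add: zero_l2.abs_eq)
qed


section \<open>Integration by parts\<close>

lemma integral_translate:
  fixes f :: "'a::euclidean_space \<Rightarrow> real"
  assumes "f \<in> borel_measurable borel"
  shows "(\<integral>x. f (x + c) \<partial>lborel) = (\<integral>x. f x \<partial>lborel)"
proof -
  have "(\<integral>x. f x \<partial>lborel) = (\<integral>x. f x \<partial>distr lborel borel ((+) c))"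
    by (simp add: lborel_distr_plus)
  also have "\<dots> = (\<integral>x. f (c + x) \<partial>lborel)"
    using assms by (intro integral_distr) auto
  finally show ?thesis by (simp add: add.commute)
qed

text \<open>The difference quotients in direction \<open>b\<close> have integral zero by translation invariance, and they converge to the
derivative. The mean value theorem bounds them by the supremum of the derivative on a fixed ball, which permits
dominated convergence.\<close>

lemma integral_partial_deriv_eq_0:
  fixes f :: "'a::euclidean_space \<Rightarrow> real"
  assumes diff: "\<And>x. f differentiable at x" and cont: "continuous_on UNIV (partial_deriv b f)"
    and K: "compact K" "\<And>x. x \<notin> K \<Longrightarrow> f x = 0"
  shows "(\<integral>x. partial_deriv b f x \<partial>lborel) = 0"
proof -
  have f_cont: "continuous_on UNIV f"
    using diff by (auto simp: continuous_on_eq_continuous_at differentiable_imp_continuous_within)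
  have f_meas [measurable]: "f \<in> borel_measurable borel"
    using f_cont by (rule borel_measurable_continuous_onI)
  have f_int: "integrable lborel f" using integrable_compact_support[OF f_cont K] .
  have f_int': "integrable lborel (\<lambda>x. f (x + c))" for c
  proof (rule integrable_compact_support)
    show "continuous_on UNIV (\<lambda>x. f (x + c))"
      by (intro continuous_on_compose2[OF f_cont] continuous_intros) auto
    show "compact ((\<lambda>x. x - c) ` K)"
      by (intro compact_continuous_image continuous_intros K)
    show "f (x + c) = 0" if "x \<notin> (\<lambda>x. x - c) ` K" for x
      by (rule K(2)) (use that in force)
  qed
  obtain R where R: "K \<subseteq> cball 0 R"
    using compact_imp_bounded[OF K(1)] by (auto simp: bounded_iff subset_iff)
  have "compact (partial_deriv b f ` K)"
    using cont by (intro compact_continuous_image K) (auto intro: continuous_on_subset)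
  then obtain M where M': "\<And>x. x \<in> K \<Longrightarrow> \<bar>partial_deriv b f x\<bar> \<le> M"
    using compact_imp_bounded by (fastforce simp: bounded_iff)
  have M: "\<bar>partial_deriv b f x\<bar> \<le> \<bar>M\<bar>" for x
    using M'[of x] partial_deriv_eq_0[OF compact_imp_closed[OF K(1)] K(2), where x = x and b = b] by (cases "x \<in> K") auto
  have line: "((\<lambda>t. f (x + t *\<^sub>R b)) has_real_derivative partial_deriv b f (x + t *\<^sub>R b)) (at t)" for x t
  proof -
    let ?D = "frechet_derivative f (at (x + t *\<^sub>R b))"
    have D: "(f has_derivative ?D) (at (x + t *\<^sub>R b))"
      using diff by (simp add: frechet_derivative_works[symmetric])
    have "((\<lambda>t. x + t *\<^sub>R b) has_derivative (\<lambda>s. s *\<^sub>R b)) (at t)"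
      by (auto intro!: derivative_eq_intros)
    from has_derivative_compose[OF this D]
    have "((\<lambda>t. f (x + t *\<^sub>R b)) has_derivative (\<lambda>s. s * ?D b)) (at t)"
      using linear_scale[OF has_derivative_linear[OF D]] by simp
    then show ?thesis
      by (simp add: has_field_derivative_def partial_deriv_def mult.commute[of _ "?D b"])
  qed
  define h where "h m = 1 / real (Suc m)" for m
  have h: "h m > 0" "h m \<le> 1" for m by (auto simp: h_def)
  define q where "q m x = (f (x + h m *\<^sub>R b) - f x) / h m" for m x
  have q_0: "(\<integral>x. q m x \<partial>lborel) = 0" for m
    using f_int f_int' by (simp add: q_def integral_translate)
  have "(\<lambda>m. \<integral>x. q m x \<partial>lborel) \<longlonglongrightarrow> (\<integral>x. partial_deriv b f x \<partial>lborel)"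
  proof (rule integral_dominated_convergence[where w = "\<lambda>x. \<bar>M\<bar> * indicator (cball 0 (R + norm b)) x"])
    show "partial_deriv b f \<in> borel_measurable lborel"
      using borel_measurable_continuous_onI[OF cont] by simp
    show "q m \<in> borel_measurable lborel" for m unfolding q_def by measurable
    show "integrable lborel (\<lambda>x. \<bar>M\<bar> * indicator (cball 0 (R + norm b)) x)"
      using emeasure_bounded_finite[OF bounded_cball[of 0 "R + norm b"]] by (intro integrable_mult_right integrable_real_indicator) auto
    have "(\<lambda>m. q m x) \<longlonglongrightarrow> partial_deriv b f x" for x
    proof -
      have "((\<lambda>s. (f (x + s *\<^sub>R b) - f x) / s) \<longlongrightarrow> partial_deriv b f x) (at 0)"
        using line[of x 0] by (simp add: DERIV_def)
      moreover have "filterlim h (at 0) sequentially"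
      proof (rule filterlim_atI)
        show "h \<longlonglongrightarrow> 0" unfolding h_def by (rule LIMSEQ_Suc[OF lim_1_over_n])
        show "\<forall>\<^sub>F m in sequentially. h m \<noteq> 0" using h(1) by (simp add: less_imp_neq[symmetric])
      qed
      ultimately show ?thesis unfolding q_def by (rule filterlim_compose)
    qed
    then show "AE x in lborel. (\<lambda>m. q m x) \<longlonglongrightarrow> partial_deriv b f x" by simp
    have "\<bar>q m x\<bar> \<le> \<bar>M\<bar> * indicator (cball 0 (R + norm b)) x" for m x
    proof (cases "x \<in> cball 0 (R + norm b)")
      case True
      obtain z where "f (x + h m *\<^sub>R b) - f (x + 0 *\<^sub>R b) = (h m - 0) * partial_deriv b f (x + z *\<^sub>R b)"
        using MVT2[of 0 "h m" "\<lambda>t. f (x + t *\<^sub>R b)" "\<lambda>t. partial_deriv b f (x + t *\<^sub>R b)"] h(1)[of m] line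
        by blast
      then have "q m x = partial_deriv b f (x + z *\<^sub>R b)" using h(1)[of m] by (simp add: q_def)
      then show ?thesis using M True by simp
    next
      case False
      have "norm (h m *\<^sub>R b) \<le> norm b" using h[of m] by (simp add: mult_left_le_one_le)
      then have "norm x \<le> norm (x + h m *\<^sub>R b) + norm b"
        using norm_triangle_ineq4[of "x + h m *\<^sub>R b" "h m *\<^sub>R b"] by simp
      moreover have "R + norm b < norm x" using False by simp
      moreover have "0 \<le> norm b" by simp
      ultimately have "R < norm x" "R < norm (x + h m *\<^sub>R b)" by linarith+
      then have "x \<notin> cball 0 R" "x + h m *\<^sub>R b \<notin> cball 0 R" by auto
      then have "f x = 0" "f (x + h m *\<^sub>R b) = 0" using R by (blast intro: K(2))+
      then have "q m x = 0" by (simp add: q_def)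
      then show ?thesis by simp
    qed
    then show "AE x in lborel. norm (q m x) \<le> \<bar>M\<bar> * indicator (cball 0 (R + norm b)) x" for m by simp
  qed
  then show ?thesis by (simp add: q_0 LIMSEQ_const_iff)
qed

lemma integration_by_parts:
  assumes \<phi>: "\<phi> \<in> test_functions \<Omega>" and \<psi>: "\<psi> \<in> test_functions \<Omega>'" and b: "b \<in> Basis"
  shows "inner (abs_l2 \<phi>) (abs_l2 (partial_deriv b \<psi>)) = - inner (abs_l2 (partial_deriv b \<phi>)) (abs_l2 \<psi>)"
proof -
  have diff: "\<phi> differentiable at x" "\<psi> differentiable at x" for x
    using test_function_smooth[OF \<phi>, of 1] test_function_smooth[OF \<psi>, of 1] by auto
  have pd: "partial_deriv b (\<lambda>x. \<phi> x * \<psi> x) = (\<lambda>x. \<phi> x * partial_deriv b \<psi> x + partial_deriv b \<phi> x * \<psi> x)"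
    using diff by (auto simp: partial_deriv_mult)
  have prod: "(\<lambda>x. \<phi> x * \<psi> x) \<in> test_functions \<Omega>'"
    using \<phi> \<psi> by (intro test_function_mult test_function_smooth)
  obtain K where K: "compact K" "\<forall>x. x \<notin> K \<longrightarrow> \<phi> x * \<psi> x = 0"
    using test_function_support[OF prod] by blast
  note sq = test_function_sq_integrable[OF \<phi>] test_function_sq_integrable[OF \<psi>]
    test_function_sq_integrable[OF partial_deriv_test_function[OF \<phi> b]]
    test_function_sq_integrable[OF partial_deriv_test_function[OF \<psi> b]]
  have "0 = (\<integral>x. partial_deriv b (\<lambda>x. \<phi> x * \<psi> x) x \<partial>lborel)"
    using K diff Ck_continuous[OF test_function_smooth[OF partial_deriv_test_function[OF prod b], of 0]]
    by (intro integral_partial_deriv_eq_0[symmetric, where K = K] differentiable_mult) auto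
  also have "\<dots> = (\<integral>x. \<phi> x * partial_deriv b \<psi> x \<partial>lborel) + (\<integral>x. partial_deriv b \<phi> x * \<psi> x \<partial>lborel)"
    unfolding pd using sq by (intro Bochner_Integration.integral_add sq_integrable_mult)
  also have "\<dots> = inner (abs_l2 \<phi>) (abs_l2 (partial_deriv b \<psi>)) + inner (abs_l2 (partial_deriv b \<phi>)) (abs_l2 \<psi>)"
    using sq by (simp add: inner_abs)
  finally show ?thesis by simp
qed

section \<open>The Poincare inequality for test functions\<close>

text \<open>Integration by parts of \<open>x\<^sub>b \<phi>\<close>, where \<open>x\<^sub>b = x \<bullet> b\<close>, against the derivative of \<open>\<phi>\<close> expresses the squared norm of \<open>\<phi>\<close>
as \<open>-2\<close> times the inner product of \<open>x\<^sub>b \<phi>\<close> and the derivative of \<open>\<phi>\<close>. As \<open>x\<^sub>b\<close> is bounded by \<open>R\<close> on \<open>\<Omega>\<close>,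
Cauchy-Schwarz finishes.\<close>

lemma Poincare_test_function:
  assumes \<phi>: "\<phi> \<in> test_functions \<Omega>" and b: "b \<in> Basis" and R: "\<Omega> \<subseteq> cball 0 R" "R \<ge> 0"
  shows "norm (abs_l2 \<phi>) \<le> 2 * R * norm (abs_l2 (partial_deriv b \<phi>))"
proof -
  define \<psi> where "\<psi> = (\<lambda>x. (x \<bullet> b) * \<phi> x)"
  define d where "d = (\<lambda>x. (x \<bullet> b) * partial_deriv b \<phi> x)"
  have \<psi>: "\<psi> \<in> test_functions \<Omega>" unfolding \<psi>_def by (intro test_function_mult \<phi> Ck_coord)
  have d: "d \<in> test_functions \<Omega>"
    unfolding d_def by (intro test_function_mult partial_deriv_test_function \<phi> b Ck_coord)
  have coord: "((\<lambda>x. x \<bullet> b) has_derivative (\<lambda>h. h \<bullet> b)) (at x)" for x :: 'a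
    by (auto intro!: derivative_eq_intros)
  have pd: "partial_deriv b \<psi> = (\<lambda>x. d x + \<phi> x)"
  proof
    fix x
    have "\<phi> differentiable at x" using test_function_smooth[OF \<phi>, of 1] by auto
    moreover have "(\<lambda>x. x \<bullet> b) differentiable at x" using coord differentiable_def by blast
    ultimately show "partial_deriv b \<psi> x = d x + \<phi> x"
      using b by (simp add: \<psi>_def d_def partial_deriv_mult partial_deriv_eq[OF coord])
  qed
  note sq = test_function_sq_integrable[OF \<phi>] test_function_sq_integrable[OF \<psi>] test_function_sq_integrable[OF d]
    test_function_sq_integrable[OF partial_deriv_test_function[OF \<phi> b]]
  have "inner (abs_l2 d) (abs_l2 \<phi>) = inner (abs_l2 \<psi>) (abs_l2 (partial_deriv b \<phi>))"
    using sq by (simp add: inner_abs \<psi>_def d_def mult_ac)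
  moreover have "inner (abs_l2 \<psi>) (abs_l2 (partial_deriv b \<phi>)) = - (inner (abs_l2 d) (abs_l2 \<phi>) + (norm (abs_l2 \<phi>))\<^sup>2)"
    using integration_by_parts[OF \<psi> \<phi> b] sq
    by (simp add: pd abs_l2_add inner_add_left power2_norm_eq_inner)
  ultimately have "(norm (abs_l2 \<phi>))\<^sup>2 = - 2 * inner (abs_l2 \<psi>) (abs_l2 (partial_deriv b \<phi>))"
    by simp
  also have "\<dots> \<le> 2 * (norm (abs_l2 \<psi>) * norm (abs_l2 (partial_deriv b \<phi>)))"
    using Cauchy_Schwarz_ineq2[of "abs_l2 \<psi>" "abs_l2 (partial_deriv b \<phi>)"] by simp
  also have "norm (abs_l2 \<psi>) \<le> \<bar>R\<bar> * norm (abs_l2 \<phi>)"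
  proof (rule power2_le_imp_le)
    have "(norm (abs_l2 \<psi>))\<^sup>2 = (\<integral>x. (\<psi> x)\<^sup>2 \<partial>lborel)"
      using sq(2) by (simp add: power2_norm_eq_inner inner_abs) (simp add: power2_eq_square)
    also have "\<dots> \<le> (\<integral>x. R\<^sup>2 * (\<phi> x)\<^sup>2 \<partial>lborel)"
    proof (rule integral_mono)
      show "integrable lborel (\<lambda>x. (\<psi> x)\<^sup>2)" "integrable lborel (\<lambda>x. R\<^sup>2 * (\<phi> x)\<^sup>2)"
        using sq by (auto simp: sq_integrable_def)
      show "(\<psi> x)\<^sup>2 \<le> R\<^sup>2 * (\<phi> x)\<^sup>2" for x
      proof (cases "\<phi> x = 0")
        case False
        then have "x \<in> \<Omega>" using test_function_support[OF \<phi>] by blast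
        then have "\<bar>x \<bullet> b\<bar> \<le> R" using R(1) Basis_le_norm[OF b, of x] by auto
        then have "(x \<bullet> b)\<^sup>2 \<le> R\<^sup>2" by (simp add: abs_le_square_iff[symmetric])
        then show ?thesis by (simp add: \<psi>_def power_mult_distrib mult_right_mono)
      qed (simp add: \<psi>_def)
    qed
    also have "\<dots> = (\<bar>R\<bar> * norm (abs_l2 \<phi>))\<^sup>2"
      using sq(1) by (simp add: power_mult_distrib power2_norm_eq_inner inner_abs) (simp add: power2_eq_square)
    finally show "(norm (abs_l2 \<psi>))\<^sup>2 \<le> (\<bar>R\<bar> * norm (abs_l2 \<phi>))\<^sup>2" .
  qed simp
  finally have le: "(norm (abs_l2 \<phi>))\<^sup>2 \<le> norm (abs_l2 \<phi>) * (2 * \<bar>R\<bar> * norm (abs_l2 (partial_deriv b \<phi>)))"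
    by (simp add: mult_left_mono mult_right_mono mult_ac)
  show ?thesis
  proof (cases "norm (abs_l2 \<phi>) = 0")
    case False
    then show ?thesis using le R(2) by (simp add: power2_eq_square)
  qed (use R(2) in simp)
qed


section \<open>Sobolev spaces on a bounded open set\<close>

locale bounded_open_set =
  fixes \<Omega> :: "'a::euclidean_space set"
  assumes open_\<Omega>: "open \<Omega>" and bounded_\<Omega>: "bounded \<Omega>"
begin

lemma \<Omega>_sets [simp]: "\<Omega> \<in> sets borel"
  using open_\<Omega> by simp

lemma is_weak_partial_unique:
  assumes "is_weak_partial \<Omega> b u g" "is_weak_partial \<Omega> b u g'"
  shows "g = g'"
proof -
  have "g - g' = 0"
  proof (rule fundamental_lemma[OF open_\<Omega>])
    have "g \<in> L2 \<Omega>" "g' \<in> L2 \<Omega>" using assms unfolding is_weak_partial_def by blast+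
    then show "g - g' \<in> L2 \<Omega>" by (rule subspace_diff[OF subspace_L2[OF \<Omega>_sets]])
    fix \<phi> assume "\<phi> \<in> test_functions \<Omega>"
    then have "- inner g (abs_l2 \<phi>) = - inner g' (abs_l2 \<phi>)"
      using assms unfolding is_weak_partial_def by metis
    then show "inner (g - g') (abs_l2 \<phi>) = 0" by (simp add: inner_diff_left)
  qed
  then show ?thesis by simp
qed

lemma weak_partial_eq:
  assumes "is_weak_partial \<Omega> b u g"
  shows "weak_partial \<Omega> b u = g"
  unfolding weak_partial_def
proof (rule the_equality)
  show "h = g" if "is_weak_partial \<Omega> b u h" for h using is_weak_partial_unique[OF that assms] .
qed (rule assms)

lemma is_weak_partial_weak_partial:
  assumes "u \<in> H1 \<Omega>" "b \<in> Basis"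
  shows "is_weak_partial \<Omega> b u (weak_partial \<Omega> b u)"
proof -
  obtain g where "is_weak_partial \<Omega> b u g" using assms by (auto simp: H1_def)
  then show ?thesis using weak_partial_eq by simp
qed

lemma is_weak_partial_add:
  "is_weak_partial \<Omega> b u g \<Longrightarrow> is_weak_partial \<Omega> b v h \<Longrightarrow> is_weak_partial \<Omega> b (u + v) (g + h)"
  by (simp add: is_weak_partial_def inner_add_left subspace_add[OF subspace_L2[OF \<Omega>_sets]])

lemma is_weak_partial_scale: "is_weak_partial \<Omega> b u g \<Longrightarrow> is_weak_partial \<Omega> b (c *\<^sub>R u) (c *\<^sub>R g)"
  by (simp add: is_weak_partial_def subspace_scale[OF subspace_L2[OF \<Omega>_sets]])

lemma is_weak_partial_limit:
  assumes "\<And>n. is_weak_partial \<Omega> b (X n) (G n)" "X \<longlonglongrightarrow> u" "G \<longlonglongrightarrow> g"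
  shows "is_weak_partial \<Omega> b u g"
  unfolding is_weak_partial_def
proof (intro conjI ballI)
  show "g \<in> L2 \<Omega>"
  proof (rule L2_limit[OF \<Omega>_sets _ assms(3)])
    show "G n \<in> L2 \<Omega>" for n using assms(1)[of n] by (simp add: is_weak_partial_def)
  qed
  fix \<phi> assume \<phi>: "\<phi> \<in> test_functions \<Omega>"
  have "(\<lambda>n. inner (X n) (abs_l2 (partial_deriv b \<phi>))) \<longlonglongrightarrow> inner u (abs_l2 (partial_deriv b \<phi>))"
    by (intro tendsto_intros assms)
  moreover have "inner (X n) (abs_l2 (partial_deriv b \<phi>)) = - inner (G n) (abs_l2 \<phi>)" for n
    using assms(1) \<phi> by (simp add: is_weak_partial_def)
  ultimately have "(\<lambda>n. - inner (G n) (abs_l2 \<phi>)) \<longlonglongrightarrow> inner u (abs_l2 (partial_deriv b \<phi>))"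
    by simp
  moreover have "(\<lambda>n. - inner (G n) (abs_l2 \<phi>)) \<longlonglongrightarrow> - inner g (abs_l2 \<phi>)"
    by (intro tendsto_intros assms)
  ultimately show "inner u (abs_l2 (partial_deriv b \<phi>)) = - inner g (abs_l2 \<phi>)"
    by (rule LIMSEQ_unique)
qed

lemma is_weak_partial_test_function:
  "\<phi> \<in> test_functions \<Omega> \<Longrightarrow> b \<in> Basis \<Longrightarrow> is_weak_partial \<Omega> b (abs_l2 \<phi>) (abs_l2 (partial_deriv b \<phi>))"
  unfolding is_weak_partial_def
  by (intro conjI ballI test_function_in_L2 partial_deriv_test_function integration_by_parts)

lemma test_function_in_H1: "\<phi> \<in> test_functions \<Omega> \<Longrightarrow> abs_l2 \<phi> \<in> H1 \<Omega>"
  unfolding H1_def by (blast intro: is_weak_partial_test_function test_function_in_L2)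

lemma subspace_H1: "subspace (H1 \<Omega>)"
  unfolding subspace_def
proof (intro conjI ballI allI)
  have zero: "is_weak_partial \<Omega> b 0 0" for b
    using subspace_0[OF subspace_L2[OF \<Omega>_sets]] by (simp add: is_weak_partial_def)
  then show "0 \<in> H1 \<Omega>" using subspace_0[OF subspace_L2[OF \<Omega>_sets]] by (auto simp: H1_def)
next
  fix u v assume uv: "u \<in> H1 \<Omega>" "v \<in> H1 \<Omega>"
  have "u + v \<in> L2 \<Omega>"
    using uv by (intro subspace_add subspace_L2) (simp_all add: H1_def)
  then show "u + v \<in> H1 \<Omega>"
    unfolding H1_def using is_weak_partial_add[OF uv[THEN is_weak_partial_weak_partial]] by blast
next
  fix c u assume u: "u \<in> H1 \<Omega>"
  have "c *\<^sub>R u \<in> L2 \<Omega>"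
    using u by (intro subspace_scale subspace_L2) (simp_all add: H1_def)
  then show "c *\<^sub>R u \<in> H1 \<Omega>"
    unfolding H1_def using is_weak_partial_scale[OF is_weak_partial_weak_partial[OF u]] by blast
qed

lemma weak_partial_add:
  "u \<in> H1 \<Omega> \<Longrightarrow> v \<in> H1 \<Omega> \<Longrightarrow> b \<in> Basis \<Longrightarrow> weak_partial \<Omega> b (u + v) = weak_partial \<Omega> b u + weak_partial \<Omega> b v"
  by (intro weak_partial_eq is_weak_partial_add is_weak_partial_weak_partial)

lemma weak_partial_scale:
  "u \<in> H1 \<Omega> \<Longrightarrow> b \<in> Basis \<Longrightarrow> weak_partial \<Omega> b (c *\<^sub>R u) = c *\<^sub>R weak_partial \<Omega> b u"
  by (intro weak_partial_eq is_weak_partial_scale is_weak_partial_weak_partial)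

lemma weak_partial_diff:
  assumes "u \<in> H1 \<Omega>" "v \<in> H1 \<Omega>" "b \<in> Basis"
  shows "weak_partial \<Omega> b (u - v) = weak_partial \<Omega> b u - weak_partial \<Omega> b v"
  using weak_partial_add[OF assms(1) subspace_scale[OF subspace_H1 assms(2)], of b "-1"]
    weak_partial_scale[of v b "-1"] assms by simp

lemma grad_inner_add_left:
  "u \<in> H1 \<Omega> \<Longrightarrow> v \<in> H1 \<Omega> \<Longrightarrow> grad_inner \<Omega> (u + v) w = grad_inner \<Omega> u w + grad_inner \<Omega> v w"
  by (simp add: grad_inner_def weak_partial_add inner_add_left sum.distrib)

lemma grad_inner_scale_left:
  "u \<in> H1 \<Omega> \<Longrightarrow> grad_inner \<Omega> (c *\<^sub>R u) w = c * grad_inner \<Omega> u w"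
  by (simp add: grad_inner_def weak_partial_scale sum_distrib_left)

lemma grad_inner_commute: "grad_inner \<Omega> u v = grad_inner \<Omega> v u"
  by (simp add: grad_inner_def inner_commute)

lemma grad_inner_nonneg: "0 \<le> grad_inner \<Omega> u u"
  by (simp add: grad_inner_def sum_nonneg)

lemma norm_weak_partial_le: "b \<in> Basis \<Longrightarrow> norm (weak_partial \<Omega> b u) \<le> sqrt (grad_inner \<Omega> u u)"
  unfolding grad_inner_def norm_eq_sqrt_inner
  by (intro real_sqrt_le_mono member_le_sum) auto

text \<open>The norm of this form is \<open>H1_norm\<close>, which inherits the triangle inequality.\<close>

sublocale H1: form_on_subspace "H1 \<Omega>" "\<lambda>u v. inner u v + grad_inner \<Omega> u v"
proof
  show "u = 0" if "inner u u + grad_inner \<Omega> u u = 0" for u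
  proof -
    have "inner u u = 0" using that grad_inner_nonneg[of u] inner_ge_zero[of u] by linarith
    then show ?thesis by simp
  qed
  show "inner u v + grad_inner \<Omega> u v = inner v u + grad_inner \<Omega> v u" for u v
    by (simp add: inner_commute grad_inner_commute)
qed (simp_all add: subspace_H1 grad_inner_add_left grad_inner_scale_left inner_add_left distrib_left
      grad_inner_nonneg add_nonneg_nonneg)

lemma H1_norm_triangle: "u \<in> H1 \<Omega> \<Longrightarrow> v \<in> H1 \<Omega> \<Longrightarrow> H1_norm \<Omega> (u + v) \<le> H1_norm \<Omega> u + H1_norm \<Omega> v"
  unfolding H1_norm_def by (rule H1.form_norm_triangle)

lemma H1_norm_scale: "u \<in> H1 \<Omega> \<Longrightarrow> H1_norm \<Omega> (c *\<^sub>R u) = \<bar>c\<bar> * H1_norm \<Omega> u"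
  unfolding H1_norm_def by (rule H1.form_norm_scale)

lemma norm_le_H1_norm: "norm u \<le> H1_norm \<Omega> u"
  unfolding H1_norm_def norm_eq_sqrt_inner using grad_inner_nonneg[of u] by simp

lemma norm_weak_partial_le_H1_norm: "b \<in> Basis \<Longrightarrow> norm (weak_partial \<Omega> b u) \<le> H1_norm \<Omega> u"
  unfolding H1_norm_def by (rule order_trans[OF norm_weak_partial_le]) simp_all

lemma H10_H1: "u \<in> H10 \<Omega> \<Longrightarrow> u \<in> H1 \<Omega>"
  by (simp add: H10_def)

lemma H10_approx:
  assumes "u \<in> H10 \<Omega>" "\<epsilon> > 0"
  shows "\<exists>\<phi>\<in>test_functions \<Omega>. H1_norm \<Omega> (u - abs_l2 \<phi>) < \<epsilon>"
  using assms by (simp add: H10_def)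

lemma subspace_H10: "subspace (H10 \<Omega>)"
  unfolding subspace_def
proof (intro conjI ballI allI)
  have "(\<lambda>_. 0) \<in> test_functions \<Omega>"
    by (rule test_functionI[where K = "{}"]) (auto intro: Ck_const)
  moreover have "H1_norm \<Omega> (0 - abs_l2 (\<lambda>_. 0)) = 0"
  proof -
    have "abs_l2 (\<lambda>_. 0) = (0 :: 'a l2)" by (simp add: zero_l2.abs_eq)
    then show ?thesis using H1_norm_scale[of 0 0] by simp
  qed
  ultimately show "0 \<in> H10 \<Omega>"
    unfolding H10_def using H1.closed_ops(1) by force
next
  fix u v assume uv: "u \<in> H10 \<Omega>" "v \<in> H10 \<Omega>"
  have "\<exists>\<phi>\<in>test_functions \<Omega>. H1_norm \<Omega> (u + v - abs_l2 \<phi>) < \<epsilon>" if "\<epsilon> > 0" for \<epsilon>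
  proof -
    obtain \<phi> where \<phi>: "\<phi> \<in> test_functions \<Omega>" "H1_norm \<Omega> (u - abs_l2 \<phi>) < \<epsilon> / 2"
      using H10_approx[OF uv(1), of "\<epsilon> / 2"] \<open>\<epsilon> > 0\<close> by auto
    obtain \<psi> where \<psi>: "\<psi> \<in> test_functions \<Omega>" "H1_norm \<Omega> (v - abs_l2 \<psi>) < \<epsilon> / 2"
      using H10_approx[OF uv(2), of "\<epsilon> / 2"] \<open>\<epsilon> > 0\<close> by auto
    have eq: "u + v - abs_l2 (\<lambda>x. \<phi> x + \<psi> x) = (u - abs_l2 \<phi>) + (v - abs_l2 \<psi>)"
      using \<phi> \<psi> by (simp add: abs_l2_add test_function_sq_integrable)
    have "H1_norm \<Omega> (u + v - abs_l2 (\<lambda>x. \<phi> x + \<psi> x)) < \<epsilon>"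
      unfolding eq using H1_norm_triangle[of "u - abs_l2 \<phi>" "v - abs_l2 \<psi>"] \<phi> \<psi> uv
      by (simp add: H10_H1 test_function_in_H1)
    then show ?thesis using test_function_add[OF \<phi>(1) \<psi>(1)] by blast
  qed
  then show "u + v \<in> H10 \<Omega>" using uv by (simp add: H10_def)
next
  fix c u assume u: "u \<in> H10 \<Omega>"
  have "\<exists>\<phi>\<in>test_functions \<Omega>. H1_norm \<Omega> (c *\<^sub>R u - abs_l2 \<phi>) < \<epsilon>" if "\<epsilon> > 0" for \<epsilon>
  proof -
    obtain \<phi> where \<phi>: "\<phi> \<in> test_functions \<Omega>" "H1_norm \<Omega> (u - abs_l2 \<phi>) < \<epsilon> / (\<bar>c\<bar> + 1)"
      using H10_approx[OF u, of "\<epsilon> / (\<bar>c\<bar> + 1)"] \<open>\<epsilon> > 0\<close> by auto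
    have "c *\<^sub>R u - abs_l2 (\<lambda>x. c * \<phi> x) = c *\<^sub>R (u - abs_l2 \<phi>)"
      using \<phi> by (simp add: abs_l2_scale test_function_sq_integrable scaleR_diff_right)
    then have "H1_norm \<Omega> (c *\<^sub>R u - abs_l2 (\<lambda>x. c * \<phi> x)) = \<bar>c\<bar> * H1_norm \<Omega> (u - abs_l2 \<phi>)"
      using H1_norm_scale[of "u - abs_l2 \<phi>"] \<phi> u by (simp add: H10_H1 test_function_in_H1)
    also have "\<dots> \<le> \<bar>c\<bar> * (\<epsilon> / (\<bar>c\<bar> + 1))" using \<phi> by (intro mult_left_mono) auto
    also have "\<dots> < \<epsilon>" using \<open>\<epsilon> > 0\<close> by (simp add: field_simps)
    finally show ?thesis using test_function_mult[OF \<phi>(1) Ck_const] by blast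
  qed
  then show "c *\<^sub>R u \<in> H10 \<Omega>" using u by (simp add: H10_def)
qed

text \<open>One partial derivative controls the norm for test functions; both sides are continuous in the norm of \<open>H1\<close>, in which the
test functions are dense in \<open>H10\<close>.\<close>

theorem Poincare_inequality: "\<exists>C\<ge>0. \<forall>u\<in>H10 \<Omega>. norm u \<le> C * sqrt (grad_inner \<Omega> u u)"
proof -
  obtain R where R: "\<Omega> \<subseteq> cball 0 R" "R \<ge> 0"
  proof -
    obtain r where "\<And>x. x \<in> \<Omega> \<Longrightarrow> norm x \<le> r" using bounded_\<Omega> by (auto simp: bounded_iff)
    then have "\<Omega> \<subseteq> cball 0 \<bar>r\<bar>" by force
    then show ?thesis using that[of "\<bar>r\<bar>"] by simp
  qed
  obtain b :: 'a where b: "b \<in> Basis" using nonempty_Basis by blast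
  have "norm u \<le> 2 * R * norm (weak_partial \<Omega> b u)" if u: "u \<in> H10 \<Omega>" for u
  proof (rule field_le_epsilon)
    fix \<epsilon> :: real assume "\<epsilon> > 0"
    define \<delta> where "\<delta> = \<epsilon> / (1 + 2 * R)"
    have \<delta>: "\<delta> > 0" "\<delta> * (1 + 2 * R) = \<epsilon>" using \<open>\<epsilon> > 0\<close> R by (auto simp: \<delta>_def)
    obtain \<phi> where \<phi>: "\<phi> \<in> test_functions \<Omega>" "H1_norm \<Omega> (u - abs_l2 \<phi>) < \<delta>"
      using H10_approx[OF u \<delta>(1)] by blast
    have "norm u \<le> norm (u - abs_l2 \<phi>) + norm (abs_l2 \<phi>)"
      using norm_triangle_ineq[of "u - abs_l2 \<phi>" "abs_l2 \<phi>"] by simp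
    also have "\<dots> \<le> \<delta> + 2 * R * norm (weak_partial \<Omega> b (abs_l2 \<phi>))"
      using norm_le_H1_norm[of "u - abs_l2 \<phi>"] \<phi> Poincare_test_function[OF \<phi>(1) b R]
        weak_partial_eq[OF is_weak_partial_test_function[OF \<phi>(1) b]] by simp
    also have "\<dots> \<le> \<delta> + 2 * R * (norm (weak_partial \<Omega> b u) + \<delta>)"
    proof -
      have "norm (weak_partial \<Omega> b (abs_l2 \<phi>)) \<le> norm (weak_partial \<Omega> b u) + norm (weak_partial \<Omega> b (u - abs_l2 \<phi>))"
        using u \<phi> b norm_triangle_ineq4[of "weak_partial \<Omega> b u" "weak_partial \<Omega> b (u - abs_l2 \<phi>)"]
        by (simp add: weak_partial_diff H10_H1 test_function_in_H1)
      also have "\<dots> \<le> norm (weak_partial \<Omega> b u) + \<delta>"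
        using norm_weak_partial_le_H1_norm[OF b, of "u - abs_l2 \<phi>"] \<phi> by simp
      finally show ?thesis using R(2) by (simp add: mult_left_mono)
    qed
    also have "\<dots> = 2 * R * norm (weak_partial \<Omega> b u) + \<epsilon>"
      unfolding \<delta>(2)[symmetric] by (simp add: algebra_simps)
    finally show "norm u \<le> 2 * R * norm (weak_partial \<Omega> b u) + \<epsilon>" .
  qed
  moreover have "2 * R * norm (weak_partial \<Omega> b u) \<le> 2 * R * sqrt (grad_inner \<Omega> u u)" for u
    using R(2) norm_weak_partial_le[OF b] by (intro mult_left_mono) auto
  ultimately have "\<forall>u\<in>H10 \<Omega>. norm u \<le> 2 * R * sqrt (grad_inner \<Omega> u u)" by (meson order_trans)
  then show ?thesis using R(2) by (intro exI[of _ "2 * R"]) auto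
qed

sublocale H10: form_on_subspace "H10 \<Omega>" "grad_inner \<Omega>"
proof
  show "u = 0" if "u \<in> H10 \<Omega>" "grad_inner \<Omega> u u = 0" for u
    using Poincare_inequality that by fastforce
  show "grad_inner \<Omega> u v = grad_inner \<Omega> v u" for u v by (rule grad_inner_commute)
qed (simp_all add: subspace_H10 H10_H1 grad_inner_add_left grad_inner_scale_left grad_inner_nonneg)

lemma H10_closed:
  assumes "u \<in> H1 \<Omega>" "\<And>n. X n \<in> H10 \<Omega>" "(\<lambda>n. H1_norm \<Omega> (u - X n)) \<longlonglongrightarrow> 0"
  shows "u \<in> H10 \<Omega>"
proof -
  have "\<exists>\<phi>\<in>test_functions \<Omega>. H1_norm \<Omega> (u - abs_l2 \<phi>) < \<epsilon>" if "\<epsilon> > 0" for \<epsilon>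
  proof -
    have "\<forall>\<^sub>F n in sequentially. H1_norm \<Omega> (u - X n) < \<epsilon> / 2"
      using order_tendstoD(2)[OF assms(3), of "\<epsilon> / 2"] \<open>\<epsilon> > 0\<close> by simp
    then obtain n where n: "H1_norm \<Omega> (u - X n) < \<epsilon> / 2"
      by (auto simp: eventually_sequentially)
    obtain \<phi> where \<phi>: "\<phi> \<in> test_functions \<Omega>" "H1_norm \<Omega> (X n - abs_l2 \<phi>) < \<epsilon> / 2"
      using H10_approx[OF assms(2)[of n], of "\<epsilon> / 2"] \<open>\<epsilon> > 0\<close> by auto
    have "H1_norm \<Omega> (u - abs_l2 \<phi>) \<le> H1_norm \<Omega> (u - X n) + H1_norm \<Omega> (X n - abs_l2 \<phi>)"
      using H1_norm_triangle[of "u - X n" "X n - abs_l2 \<phi>"] assms(1,2) \<phi>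
      by (simp add: H10_H1 test_function_in_H1)
    then show ?thesis using n \<phi> by (intro bexI[of _ \<phi>]) auto
  qed
  then show ?thesis using assms(1) by (simp add: H10_def)
qed

text \<open>By the Poincare inequality a sequence that is Cauchy in the gradient norm is Cauchy in L2 together with its weak partial
derivatives. The weak derivative relation and \<open>H10\<close> are closed under the resulting limits.\<close>

theorem H10_complete:
  assumes X: "\<And>n. X n \<in> H10 \<Omega>"
    and Cauchy: "\<And>e. e > 0 \<Longrightarrow> \<exists>N. \<forall>m\<ge>N. \<forall>n\<ge>N. grad_inner \<Omega> (X m - X n) (X m - X n) < e"
  shows "\<exists>u\<in>H10 \<Omega>. (\<lambda>n. grad_inner \<Omega> (X n - u) (X n - u)) \<longlonglongrightarrow> 0"
proof -
  have Cauchy_l2: "Cauchy Y" if le: "\<And>m n. norm (Y m - Y n) \<le> C * sqrt (grad_inner \<Omega> (X m - X n) (X m - X n))" "C \<ge> 0"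
    for Y :: "nat \<Rightarrow> 'a l2" and C
  proof (rule CauchyI)
    fix e :: real assume "e > 0"
    then have "(e / (C + 1))\<^sup>2 > 0" using \<open>C \<ge> 0\<close> by simp
    then obtain N where N: "\<And>m n. m \<ge> N \<Longrightarrow> n \<ge> N \<Longrightarrow> grad_inner \<Omega> (X m - X n) (X m - X n) < (e / (C + 1))\<^sup>2"
      using Cauchy by blast
    have "norm (Y m - Y n) < e" if "m \<ge> N" "n \<ge> N" for m n
    proof -
      have "sqrt (grad_inner \<Omega> (X m - X n) (X m - X n)) \<le> e / (C + 1)"
        using N[OF that] \<open>e > 0\<close> \<open>C \<ge> 0\<close> by (intro real_le_lsqrt) auto
      then have "norm (Y m - Y n) \<le> C * (e / (C + 1))"
        using \<open>C \<ge> 0\<close> by (intro order_trans[OF le(1)] mult_left_mono)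
      also have "\<dots> < e" using \<open>e > 0\<close> \<open>C \<ge> 0\<close> by (simp add: field_simps)
      finally show ?thesis .
    qed
    then show "\<exists>N. \<forall>m\<ge>N. \<forall>n\<ge>N. norm (Y m - Y n) < e" by blast
  qed
  obtain C where C: "C \<ge> 0" "\<And>u. u \<in> H10 \<Omega> \<Longrightarrow> norm u \<le> C * sqrt (grad_inner \<Omega> u u)"
    using Poincare_inequality by blast
  have "Cauchy X"
    by (rule Cauchy_l2[OF C(2) C(1)]) (simp add: X)
  then obtain u where u: "X \<longlonglongrightarrow> u"
    using Cauchy_l2_convergent[of X] by (auto simp: convergent_def)
  have "\<exists>g. (\<lambda>n. weak_partial \<Omega> b (X n)) \<longlonglongrightarrow> g" if b: "b \<in> Basis" for b
  proof -
    have "Cauchy (\<lambda>n. weak_partial \<Omega> b (X n))"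
      using norm_weak_partial_le[OF b] X b
      by (intro Cauchy_l2[of _ 1]) (simp_all add: weak_partial_diff[symmetric] H10_H1)
    from Cauchy_l2_convergent[OF this] show ?thesis by (simp add: convergent_def)
  qed
  then obtain g where g: "\<And>b. b \<in> Basis \<Longrightarrow> (\<lambda>n. weak_partial \<Omega> b (X n)) \<longlonglongrightarrow> g b" by metis
  have g_partial: "is_weak_partial \<Omega> b u (g b)" if b: "b \<in> Basis" for b
    using is_weak_partial_limit[OF is_weak_partial_weak_partial[OF H10_H1[OF X] b] u g[OF b]] .
  have "u \<in> L2 \<Omega>"
  proof (rule L2_limit[OF \<Omega>_sets _ u])
    show "X n \<in> L2 \<Omega>" for n using H10_H1[OF X[of n]] by (simp add: H1_def)
  qed
  then have u_H1: "u \<in> H1 \<Omega>" unfolding H1_def using g_partial by blast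
  have grad: "(\<lambda>n. grad_inner \<Omega> (X n - u) (X n - u)) \<longlonglongrightarrow> 0"
  proof -
    have "grad_inner \<Omega> (X n - u) (X n - u)
        = (\<Sum>b\<in>Basis. inner (weak_partial \<Omega> b (X n) - g b) (weak_partial \<Omega> b (X n) - g b))" for n
      using X u_H1 by (simp add: grad_inner_def weak_partial_diff H10_H1 weak_partial_eq[OF g_partial])
    moreover have "(\<lambda>n. \<Sum>b\<in>Basis. inner (weak_partial \<Omega> b (X n) - g b) (weak_partial \<Omega> b (X n) - g b))
        \<longlonglongrightarrow> (\<Sum>b\<in>Basis. inner (g b - g b) (g b - g b))"
      by (intro tendsto_intros g)
    ultimately show ?thesis by simp
  qed
  have "(\<lambda>n. H1_norm \<Omega> (X n - u)) \<longlonglongrightarrow> sqrt (inner (u - u) (u - u) + 0)"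
    unfolding H1_norm_def by (intro tendsto_intros u grad)
  moreover have "H1_norm \<Omega> (X n - u) = H1_norm \<Omega> (u - X n)" for n
    using H1_norm_scale[of "u - X n" "-1"] u_H1 X by (simp add: H10_H1)
  ultimately have "(\<lambda>n. H1_norm \<Omega> (u - X n)) \<longlonglongrightarrow> 0" by simp
  then have "u \<in> H10 \<Omega>" by (rule H10_closed[OF u_H1 X])
  then show ?thesis using grad by blast
qed


section \<open>The weak Laplace operator\<close>

lemma weak_laplace_diff:
  "u \<in> H10 \<Omega> \<Longrightarrow> w \<in> H10 \<Omega> \<Longrightarrow> weak_laplace \<Omega> (u - w) = (\<lambda>v. weak_laplace \<Omega> u v - weak_laplace \<Omega> w v)"
  by (auto simp: weak_laplace_def H10.form_simps)

text \<open>By definition \<open>weak_laplace\<close> is the Riesz map of the gradient inner product. Functionals in \<open>Hm1\<close> vanish outside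
\<open>H10\<close>, which is what makes equality on \<open>H10\<close> equality of functions.\<close>

theorem bij_weak_laplace: "bij_betw (weak_laplace \<Omega>) (H10 \<Omega>) (Hm1 \<Omega>)"
  unfolding bij_betw_def
proof (intro conjI equalityI subsetI)
  show "inj_on (weak_laplace \<Omega>) (H10 \<Omega>)"
  proof (rule inj_onI)
    fix u w assume uw: "u \<in> H10 \<Omega>" "w \<in> H10 \<Omega>" and eq: "weak_laplace \<Omega> u = weak_laplace \<Omega> w"
    have "grad_inner \<Omega> u v = grad_inner \<Omega> w v" if "v \<in> H10 \<Omega>" for v
      using fun_cong[OF eq, of v] that by (simp add: weak_laplace_def)
    then show "u = w" using uw by (intro H10.eq_if_form_eq)
  qed
next
  fix F assume "F \<in> weak_laplace \<Omega> ` H10 \<Omega>"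
  then obtain u where u: "u \<in> H10 \<Omega>" "F = weak_laplace \<Omega> u" by blast
  have "\<exists>C. \<forall>v\<in>H10 \<Omega>. \<bar>F v\<bar> \<le> C * H10_norm \<Omega> v"
    using H10.abs_form_le[OF u(1)]
    by (intro exI[of _ "H10_norm \<Omega> u"]) (auto simp: u(2) weak_laplace_def H10_norm_def)
  then show "F \<in> Hm1 \<Omega>" using u by (simp add: Hm1_def weak_laplace_def H10.form_simps)
next
  fix F assume F: "F \<in> Hm1 \<Omega>"
  obtain C where C: "\<And>u. u \<in> H10 \<Omega> \<Longrightarrow> \<bar>F u\<bar> \<le> C * sqrt (grad_inner \<Omega> u u)"
    using F unfolding Hm1_def H10_norm_def by blast
  have "\<exists>u\<in>H10 \<Omega>. \<forall>v\<in>H10 \<Omega>. grad_inner \<Omega> u v = F v"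
    using F C by (intro H10.Riesz_representation[OF H10_complete]) (auto simp: Hm1_def)
  then obtain u where u: "u \<in> H10 \<Omega>" "\<And>v. v \<in> H10 \<Omega> \<Longrightarrow> grad_inner \<Omega> u v = F v" by blast
  have "weak_laplace \<Omega> u = F"
  proof
    show "weak_laplace \<Omega> u v = F v" for v
      using F u by (auto simp: weak_laplace_def Hm1_def)
  qed
  then show "F \<in> weak_laplace \<Omega> ` H10 \<Omega>" using u(1) by blast
qed

lemma weak_laplace_inv: "g \<in> Hm1 \<Omega> \<Longrightarrow> weak_laplace \<Omega> (inv_laplace \<Omega> g) = g"
  unfolding inv_laplace_def using bij_weak_laplace by (rule bij_betw_inv_into_right)

lemma inv_weak_laplace: "u \<in> H10 \<Omega> \<Longrightarrow> inv_laplace \<Omega> (weak_laplace \<Omega> u) = u"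
  unfolding inv_laplace_def using bij_weak_laplace by (rule bij_betw_inv_into_left)

lemma inv_laplace_in: "g \<in> Hm1 \<Omega> \<Longrightarrow> inv_laplace \<Omega> g \<in> H10 \<Omega>"
  unfolding inv_laplace_def using bij_betw_apply[OF bij_betw_inv_into[OF bij_weak_laplace]] .

lemma inv_laplace_add:
  assumes "g \<in> Hm1 \<Omega>" "h \<in> Hm1 \<Omega>"
  shows "inv_laplace \<Omega> (\<lambda>v. g v + h v) = inv_laplace \<Omega> g + inv_laplace \<Omega> h"
proof -
  have "weak_laplace \<Omega> (inv_laplace \<Omega> g + inv_laplace \<Omega> h)
      = (\<lambda>v. weak_laplace \<Omega> (inv_laplace \<Omega> g) v + weak_laplace \<Omega> (inv_laplace \<Omega> h) v)"
    using assms by (auto simp: weak_laplace_def H10.form_simps inv_laplace_in)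
  then have "weak_laplace \<Omega> (inv_laplace \<Omega> g + inv_laplace \<Omega> h) = (\<lambda>v. g v + h v)"
    using assms by (simp add: weak_laplace_inv)
  then show ?thesis
    using inv_weak_laplace[of "inv_laplace \<Omega> g + inv_laplace \<Omega> h"] assms by (simp add: inv_laplace_in)
qed

end

section \<open>The Ritz projection\<close>

locale ritz_projection = bounded_open_set \<Omega> for \<Omega> :: "'a::euclidean_space set" +
  fixes Vh :: "'a l2 set"
  assumes Vh: "subspace Vh" "Vh \<subseteq> H10 \<Omega>" and Vh_finite: "\<exists>B. finite B \<and> Vh = span B"
begin

lemma Vh_H10: "u \<in> Vh \<Longrightarrow> u \<in> H10 \<Omega>"
  using Vh by blast

lemma Vperp_H10: "u \<in> Vperp \<Omega> Vh \<Longrightarrow> u \<in> H10 \<Omega>"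
  by (simp add: Vperp_def)

lemma subspace_Vperp: "subspace (Vperp \<Omega> Vh)"
  unfolding subspace_def by (simp add: Vperp_def Vh_H10 H10.form_simps)

lemma Vh_Vperp_disjoint: "w \<in> Vh \<Longrightarrow> w \<in> Vperp \<Omega> Vh \<Longrightarrow> w = 0"
  by (auto simp: Vperp_def intro: H10.definite)

lemma ritz_exists:
  assumes "u \<in> H10 \<Omega>"
  shows "\<exists>w\<in>Vh. u - w \<in> Vperp \<Omega> Vh"
proof -
  obtain B where B: "finite B" "Vh = span B" using Vh_finite by blast
  moreover have "B \<subseteq> H10 \<Omega>" using B Vh span_superset by blast
  ultimately obtain w where "w \<in> Vh" "\<forall>v\<in>Vh. grad_inner \<Omega> (u - w) v = 0"
    using H10.projection_exists[OF B(1) _ assms] by blast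
  then show ?thesis using assms by (auto simp: Vperp_def Vh_H10)
qed

lemma ritz_eq:
  assumes "w \<in> Vh" "u - w \<in> Vperp \<Omega> Vh"
  shows "ritz \<Omega> Vh u = w"
  unfolding ritz_def
proof (rule the_equality)
  show "w \<in> Vh \<and> (\<forall>v\<in>Vh. grad_inner \<Omega> (u - w) v = 0)" using assms by (simp add: Vperp_def)
  fix w' assume w': "w' \<in> Vh \<and> (\<forall>v\<in>Vh. grad_inner \<Omega> (u - w') v = 0)"
  have "u \<in> H10 \<Omega>"
    using H10.closed_ops(2)[OF Vperp_H10[OF assms(2)] Vh_H10[OF assms(1)]] by simp
  then have "u - w' \<in> Vperp \<Omega> Vh" using w' by (simp add: Vperp_def Vh_H10)
  then have "(u - w) - (u - w') \<in> Vperp \<Omega> Vh" by (rule subspace_diff[OF subspace_Vperp assms(2)])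
  moreover have "w' - w \<in> Vh" using w' assms by (intro subspace_diff Vh) auto
  ultimately show "w' = w" using Vh_Vperp_disjoint[of "w' - w"] by simp
qed

lemma ritz_in: "u \<in> H10 \<Omega> \<Longrightarrow> ritz \<Omega> Vh u \<in> Vh"
  using ritz_exists ritz_eq by blast

lemma diff_ritz_in: "u \<in> H10 \<Omega> \<Longrightarrow> u - ritz \<Omega> Vh u \<in> Vperp \<Omega> Vh"
  using ritz_exists ritz_eq by blast

lemma ritz_add:
  assumes "u \<in> H10 \<Omega>" "v \<in> H10 \<Omega>"
  shows "ritz \<Omega> Vh (u + v) = ritz \<Omega> Vh u + ritz \<Omega> Vh v"
proof (rule ritz_eq)
  show "ritz \<Omega> Vh u + ritz \<Omega> Vh v \<in> Vh" using assms by (intro subspace_add Vh ritz_in)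
  have "(u - ritz \<Omega> Vh u) + (v - ritz \<Omega> Vh v) \<in> Vperp \<Omega> Vh"
    using assms by (intro subspace_add subspace_Vperp diff_ritz_in)
  then show "u + v - (ritz \<Omega> Vh u + ritz \<Omega> Vh v) \<in> Vperp \<Omega> Vh" by (simp add: algebra_simps)
qed

lemma ritz_diff:
  assumes "u \<in> H10 \<Omega>" "v \<in> H10 \<Omega>"
  shows "ritz \<Omega> Vh (u - v) = ritz \<Omega> Vh u - ritz \<Omega> Vh v"
  using ritz_add[of "u - v" v] assms by simp

lemma ritz_Vh: "x \<in> Vh \<Longrightarrow> ritz \<Omega> Vh x = x"
  by (rule ritz_eq) (simp_all add: subspace_0[OF subspace_Vperp])

lemma ritz_Vperp: "y \<in> Vperp \<Omega> Vh \<Longrightarrow> ritz \<Omega> Vh y = 0"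
  by (rule ritz_eq) (simp_all add: subspace_0[OF Vh(1)])

end


section \<open>The linearized operator\<close>

locale linearized_problem = ritz_projection \<Omega> Vh for \<Omega> :: "'a::euclidean_space set" and Vh +
  fixes f' :: "'a l2 \<Rightarrow> 'a l2 \<Rightarrow> real"
  assumes f'_Hm1: "\<And>u. u \<in> H10 \<Omega> \<Longrightarrow> f' u \<in> Hm1 \<Omega>"
    and f'_add: "\<And>u w. u \<in> H10 \<Omega> \<Longrightarrow> w \<in> H10 \<Omega> \<Longrightarrow> f' (u + w) = (\<lambda>v. f' u v + f' w v)"
begin

definition A_inv_f' :: "'a l2 \<Rightarrow> 'a l2" where
  "A_inv_f' u = inv_laplace \<Omega> (f' u)"

lemma A_inv_f'_in [simp]: "u \<in> H10 \<Omega> \<Longrightarrow> A_inv_f' u \<in> H10 \<Omega>"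
  by (simp add: A_inv_f'_def inv_laplace_in f'_Hm1)

lemma A_inv_f'_add: "u \<in> H10 \<Omega> \<Longrightarrow> w \<in> H10 \<Omega> \<Longrightarrow> A_inv_f' (u + w) = A_inv_f' u + A_inv_f' w"
  by (simp add: A_inv_f'_def f'_add inv_laplace_add f'_Hm1)

text \<open>This is the factorization \<open>L = A (I - A\<^sup>-\<^sup>1 f')\<close>. As \<open>A\<close> is bijective, all questions about \<open>L\<close> become questions
about the second factor, which acts inside \<open>H10\<close>.\<close>

lemma L_op_eq: "u \<in> H10 \<Omega> \<Longrightarrow> L_op \<Omega> f' u = weak_laplace \<Omega> (u - A_inv_f' u)"
  by (simp add: L_op_def weak_laplace_diff) (simp add: A_inv_f'_def weak_laplace_inv f'_Hm1)

lemma Ah_inv_f': "Ah_inv \<Omega> Vh (f' u) = ritz \<Omega> Vh (A_inv_f' u)"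
  by (simp add: Ah_inv_def A_inv_f'_def)

lemma Aperp_inv_f': "Aperp_inv \<Omega> Vh (f' u) = A_inv_f' u - ritz \<Omega> Vh (A_inv_f' u)"
  by (simp add: Aperp_inv_def A_inv_f'_def)

lemma T_op_eq: "u \<in> H10 \<Omega> \<Longrightarrow> T_op \<Omega> Vh f' u = ritz \<Omega> Vh (u - A_inv_f' u)"
  by (simp add: T_op_def L_op_eq inv_weak_laplace)

text \<open>The block operator is \<open>I - A\<^sup>-\<^sup>1 f'\<close> written in the coordinates of the orthogonal decomposition of \<open>H10\<close> into
\<open>Vh\<close> and \<open>Vperp\<close>: adding the two components, applying the operator, and splitting again by the Ritz projection.\<close>

lemma D_op_eq:
  assumes x: "x \<in> Vh" and y: "y \<in> Vperp \<Omega> Vh"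
  defines "z \<equiv> (x + y) - A_inv_f' (x + y)"
  shows "D_op \<Omega> Vh f' (x, y) = (ritz \<Omega> Vh z, z - ritz \<Omega> Vh z)"
proof -
  have xy: "x \<in> H10 \<Omega>" "y \<in> H10 \<Omega>" using x y by (auto simp: Vh_H10 Vperp_H10)
  have "ritz \<Omega> Vh z = x - ritz \<Omega> Vh (A_inv_f' x) - ritz \<Omega> Vh (A_inv_f' y)"
    using xy by (simp add: z_def A_inv_f'_add ritz_add ritz_diff ritz_Vh[OF x] ritz_Vperp[OF y])
  then show ?thesis
    using xy
    by (simp add: D_op_def block_op_def T_op_eq Ah_inv_f' Aperp_inv_f' ritz_diff ritz_Vh[OF x])
      (simp add: z_def A_inv_f'_add)
qed

text \<open>The decomposition is a bijection of \<open>H10\<close> with the product of its summands, so bijectivity passes from the block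
operator to \<open>I - A\<^sup>-\<^sup>1 f'\<close> and, composed with the bijective \<open>A\<close>, to \<open>L\<close>.\<close>

lemma bij_L_op:
  assumes D: "bij_betw (D_op \<Omega> Vh f') (Vh \<times> Vperp \<Omega> Vh) (Vh \<times> Vperp \<Omega> Vh)"
  shows "bij_betw (L_op \<Omega> f') (H10 \<Omega>) (Hm1 \<Omega>)"
proof -
  have split: "w - A_inv_f' w \<in> H10 \<Omega>" "D_op \<Omega> Vh f' (ritz \<Omega> Vh w, w - ritz \<Omega> Vh w)
      = (ritz \<Omega> Vh (w - A_inv_f' w), (w - A_inv_f' w) - ritz \<Omega> Vh (w - A_inv_f' w))" if "w \<in> H10 \<Omega>" for w
    using that D_op_eq[OF ritz_in diff_ritz_in, of w w] by simp_all
  have components_determine: "u = v" if "(ritz \<Omega> Vh u, u - ritz \<Omega> Vh u) = (ritz \<Omega> Vh v, v - ritz \<Omega> Vh v)" for u v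
    using that by (metis prod.inject diff_add_cancel)
  have "bij_betw (\<lambda>w. w - A_inv_f' w) (H10 \<Omega>) (H10 \<Omega>)"
    unfolding bij_betw_def
  proof (intro conjI equalityI subsetI)
    show "inj_on (\<lambda>w. w - A_inv_f' w) (H10 \<Omega>)"
    proof (rule inj_onI)
      fix w w' assume w: "w \<in> H10 \<Omega>" "w' \<in> H10 \<Omega>" and eq: "w - A_inv_f' w = w' - A_inv_f' w'"
      have "D_op \<Omega> Vh f' (ritz \<Omega> Vh w, w - ritz \<Omega> Vh w) = D_op \<Omega> Vh f' (ritz \<Omega> Vh w', w' - ritz \<Omega> Vh w')"
        using split(2) w eq by simp
      then have "(ritz \<Omega> Vh w, w - ritz \<Omega> Vh w) = (ritz \<Omega> Vh w', w' - ritz \<Omega> Vh w')"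
        by (rule inj_onD[OF bij_betw_imp_inj_on[OF D]]) (simp_all add: w ritz_in diff_ritz_in)
      then show "w = w'" by (rule components_determine)
    qed
    show "z \<in> H10 \<Omega>" if "z \<in> (\<lambda>w. w - A_inv_f' w) ` H10 \<Omega>" for z
      using that split(1) by blast
    show "z \<in> (\<lambda>w. w - A_inv_f' w) ` H10 \<Omega>" if z: "z \<in> H10 \<Omega>" for z
    proof -
      have "(ritz \<Omega> Vh z, z - ritz \<Omega> Vh z) \<in> D_op \<Omega> Vh f' ` (Vh \<times> Vperp \<Omega> Vh)"
        using bij_betw_imp_surj_on[OF D] z by (simp add: ritz_in diff_ritz_in)
      then obtain x y where xy: "x \<in> Vh" "y \<in> Vperp \<Omega> Vh"
        and "D_op \<Omega> Vh f' (x, y) = (ritz \<Omega> Vh z, z - ritz \<Omega> Vh z)" by force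
      then have "(x + y) - A_inv_f' (x + y) = z" using D_op_eq[OF xy] by (intro components_determine) (simp only:)
      moreover have "x + y \<in> H10 \<Omega>" using xy by (simp add: Vh_H10 Vperp_H10)
      ultimately show ?thesis by blast
    qed
  qed
  then have "bij_betw (weak_laplace \<Omega> \<circ> (\<lambda>w. w - A_inv_f' w)) (H10 \<Omega>) (Hm1 \<Omega>)"
    using bij_weak_laplace by (rule bij_betw_trans)
  then show ?thesis
    by (rule bij_betw_cong[THEN iffD1, rotated]) (simp add: L_op_eq)
qed

text \<open>The algebraic premises of \<open>block_elimination\<close>, in the same order.\<close>

lemma block_elimination_premises:
  "x \<in> Vh \<Longrightarrow> x' \<in> Vh \<Longrightarrow> x + x' \<in> Vh"
  "x \<in> Vh \<Longrightarrow> x' \<in> Vh \<Longrightarrow> x - x' \<in> Vh"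
  "y \<in> Vperp \<Omega> Vh \<Longrightarrow> y' \<in> Vperp \<Omega> Vh \<Longrightarrow> y + y' \<in> Vperp \<Omega> Vh"
  "y \<in> Vperp \<Omega> Vh \<Longrightarrow> y' \<in> Vperp \<Omega> Vh \<Longrightarrow> y - y' \<in> Vperp \<Omega> Vh"
  "y \<in> Vperp \<Omega> Vh \<Longrightarrow> Ah_inv \<Omega> Vh (f' y) \<in> Vh"
  "x \<in> Vh \<Longrightarrow> Aperp_inv \<Omega> Vh (f' x) \<in> Vperp \<Omega> Vh"
  "y \<in> Vperp \<Omega> Vh \<Longrightarrow> y - Aperp_inv \<Omega> Vh (f' y) \<in> Vperp \<Omega> Vh"
  "x \<in> Vh \<Longrightarrow> x' \<in> Vh \<Longrightarrow> T_op \<Omega> Vh f' (x + x') = T_op \<Omega> Vh f' x + T_op \<Omega> Vh f' x'"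
  "y \<in> Vperp \<Omega> Vh \<Longrightarrow> y' \<in> Vperp \<Omega> Vh \<Longrightarrow>
    Ah_inv \<Omega> Vh (f' (y + y')) = Ah_inv \<Omega> Vh (f' y) + Ah_inv \<Omega> Vh (f' y')"
  "x \<in> Vh \<Longrightarrow> x' \<in> Vh \<Longrightarrow>
    Aperp_inv \<Omega> Vh (f' (x + x')) = Aperp_inv \<Omega> Vh (f' x) + Aperp_inv \<Omega> Vh (f' x')"
  "y \<in> Vperp \<Omega> Vh \<Longrightarrow> y' \<in> Vperp \<Omega> Vh \<Longrightarrow>
    y + y' - Aperp_inv \<Omega> Vh (f' (y + y')) = (y - Aperp_inv \<Omega> Vh (f' y)) + (y' - Aperp_inv \<Omega> Vh (f' y'))"
  by (simp_all add: subspace_add[OF Vh(1)] subspace_diff[OF Vh(1)] subspace_add[OF subspace_Vperp]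
      subspace_diff[OF subspace_Vperp] Ah_inv_f' Aperp_inv_f' T_op_eq Vh_H10 Vperp_H10 ritz_in diff_ritz_in
      A_inv_f'_add ritz_add ritz_diff)

end

theorem theorem2p1:
  fixes \<Omega> :: "'a::euclidean_space set"
    and f f' :: "'a l2 \<Rightarrow> ('a l2 \<Rightarrow> real)"
    and Vh :: "'a l2 set"
    and u_hat :: "'a l2"
  assumes "DIM('a) \<in> {1, 2, 3}"
    and "bounded_lipschitz_domain \<Omega>"
    and "f \<in> H10 \<Omega> \<rightarrow> Hm1 \<Omega>"
    and "Vh \<subseteq> H10 \<Omega>" and "subspace Vh" and "\<exists>B. finite B \<and> Vh = span B"
    and "u_hat \<in> Vh"
    and "has_frechet_derivative \<Omega> f f' u_hat"
    and "bij_betw (T_op \<Omega> Vh f') Vh Vh"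
    and "bij_betw (S_op \<Omega> Vh f') (Vperp \<Omega> Vh) (Vperp \<Omega> Vh)"
  shows "bij_betw (D_op \<Omega> Vh f') (Vh \<times> Vperp \<Omega> Vh) (Vh \<times> Vperp \<Omega> Vh)
    \<and> bij_betw (L_op \<Omega> f') (H10 \<Omega>) (Hm1 \<Omega>)
    \<and> (\<forall>g \<in> Hm1 \<Omega>. \<forall>\<phi>h \<in> Vh. \<forall>\<phi>p \<in> Vperp \<Omega> Vh.
         D_op \<Omega> Vh f' (\<phi>h, \<phi>p) = (Ah_inv \<Omega> Vh g, Aperp_inv \<Omega> Vh g) \<longrightarrow>
         (\<phi>h, \<phi>p) =
           (let T' = T_inv \<Omega> Vh f';
                S' = S_inv \<Omega> Vh f';
                Ah = Ah_inv \<Omega> Vh;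
                Ap = Aperp_inv \<Omega> Vh
            in block_op
                 (\<lambda>x. T' x + T' (Ah (f' (S' (Ap (f' (T' x)))))))   (\<lambda>y. T' (Ah (f' (S' y))))
                 (\<lambda>x. S' (Ap (f' (T' x))))                          S'
                 (Ah g, Ap g)))"
proof -
  interpret linearized_problem \<Omega> Vh f'
  proof
    show "open \<Omega>" "bounded \<Omega>" using assms(2) by (simp_all add: bounded_lipschitz_domain_def)
  qed (use assms(4-6,8) in \<open>auto simp: has_frechet_derivative_def bounded_linear_H10_Hm1_def\<close>)
  have S_op: "S_op \<Omega> Vh f' = (\<lambda>y. y - Aperp_inv \<Omega> Vh (f' y)
      - Aperp_inv \<Omega> Vh (f' (inv_into Vh (T_op \<Omega> Vh f') (Ah_inv \<Omega> Vh (f' y)))))"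
    by (simp add: fun_eq_iff S_op_def T_inv_def)
  note elimination = block_elimination[OF block_elimination_premises assms(9) assms(10)[unfolded S_op],
      folded S_op, folded D_op_def T_inv_def S_inv_def]
  have D: "bij_betw (D_op \<Omega> Vh f') (Vh \<times> Vperp \<Omega> Vh) (Vh \<times> Vperp \<Omega> Vh)"
    using elimination(1) .
  have rhs_in: "Ah_inv \<Omega> Vh g \<in> Vh" "Aperp_inv \<Omega> Vh g \<in> Vperp \<Omega> Vh" if "g \<in> Hm1 \<Omega>" for g
    using that by (simp_all add: Ah_inv_def Aperp_inv_def ritz_in diff_ritz_in inv_laplace_in)
  show ?thesis unfolding Let_def
    by (intro conjI ballI impI D bij_L_op[OF D] elimination(2) rhs_in)
qed

end
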